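(* Let $P$ be a finite partially ordered set. Then the chain polytope $\mathcal{C}(P)$ of $P$ possesses a regular unimodular triangulation arising from a flag complex; that is, there is a triangulation of $\mathcal{C}(P)$ that is regular, unimodular, and whose underlying simplicial complex is flag.
   Context: Let $P = \{x_1,\ldots,x_d\}$ be a finite poset. The chain polytope $\mathcal{C}(P) \subset \mathbb{R}^d$ is the set of all $(a_1,\ldots,a_d) \in \mathbb{R}^d$ such that $a_i \geq 0$ for all $1 \le i \le d$ and $a_{i_1} + \cdots + a_{i_k} \leq 1$ for every maximal chain $x_{i_1} < \cdots < x_{i_k}$ of $P$. Its vertices are the vectors $\rho(A) = \sum_{x_i \in A} \mathbf{e}_i$, where $A$ ranges over the antichains of $P$ (subsets of pairwise incomparable elements, including $\emptyset$) and $\mathbf{e}_1,\ldots,\mathbf{e}_d$ are the unit coordinate vectors; these are exactly the lattice points of $\mathcal{C}(P)$. Triangulations here use only lattice points of $\mathcal{C}(P)$ as vertices. Such a triangulation is unimodular if each of its maximal simplices is a $d$-dimensional simplex of Euclidean volume $1/d!$ (equivalently, the edge vectors from any one of its vertices form a $\mathbb{Z}$-basis of $\mathbb{Z}^d$). It is regular if it is induced by some real-valued height function $\omega$ on the set $V$ of lattice points of $\mathcal{C}(P)$, i.e. if its simplices are the projections to $\mathbb{R}^d$ of the lower faces of the convex hull of $\{(v,\omega(v)) : v \in V\} \subset \mathbb{R}^{d+1}$. A simplicial complex is flag if every minimal non-face (among subsets of its vertex set) has exactly two elements, i.e. any set of vertices that are pairwise joined by edges is a face. *)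

theory Defs
  imports "HOL-Analysis.Analysis"
begin

text \<open>
  A finite poset is a set \<open>P\<close> with a relation \<open>r\<close> such that \<open>partial_order_on P r\<close>, where \<open>P\<close> is
  any subset (possibly empty) of a finite type \<open>'a\<close>. The space of real vectors indexed by \<open>P\<close>
  is the coordinate subspace of \<open>real ^ 'a\<close> on which all coordinates outside \<open>P\<close> vanish; its
  dimension is \<open>card P\<close>, and it is the whole space when \<open>P = UNIV\<close>.
\<close>

definition coord_space :: "'a::finite set \<Rightarrow> (real ^ 'a) set" where
  "coord_space P = {v. \<forall>i. i \<notin> P \<longrightarrow> v $ i = 0}"

definition lattice_points :: "(real ^ 'a::finite) set \<Rightarrow> (real ^ 'a) set" where
  "lattice_points Q = {v \<in> Q. \<forall>i. v $ i \<in> \<int>}"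

definition chain_polytope :: "'a::finite set \<Rightarrow> 'a rel \<Rightarrow> (real ^ 'a) set" where
  "chain_polytope P r =
     {v \<in> coord_space P. (\<forall>i\<in>P. 0 \<le> v $ i) \<and>
        (\<forall>C. pred_on.maxchain P (\<lambda>x y. (x, y) \<in> r) C \<longrightarrow> (\<Sum>i\<in>C. v $ i) \<le> 1)}"

definition vertices :: "'b::real_vector set \<Rightarrow> 'b set" where
  "vertices S = {v. v extreme_point_of S}"

text \<open>
  As usual for \<^const>\<open>simplicial_complex\<close>, the members are geometric simplices, and the empty set
  (the simplex of dimension \<open>-1\<close>) is one of them.
\<close>

definition lattice_triangulation ::
    "(real ^ 'a::finite) set \<Rightarrow> (real ^ 'a) set set \<Rightarrow> bool" where
  "lattice_triangulation Q T \<longleftrightarrow>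
     simplicial_complex T \<and> \<Union>T = Q \<and> (\<forall>S\<in>T. vertices S \<subseteq> lattice_points Q)"

text \<open>
  A lower face is the intersection with a supporting hyperplane whose inner normal has positive
  last coordinate. The empty face is included, in accordance with the convention above.
\<close>

definition lower_face :: "('b::euclidean_space \<times> real) set \<Rightarrow> ('b \<times> real) set \<Rightarrow> bool" where
  "lower_face F K \<longleftrightarrow>
     (\<exists>c t b. 0 < t \<and> (\<forall>p\<in>K. b \<le> inner (c, t) p) \<and> F = {p \<in> K. inner (c, t) p = b})"

definition regular_triangulation ::
    "(real ^ 'a::finite) set \<Rightarrow> (real ^ 'a) set set \<Rightarrow> bool" where
  "regular_triangulation Q T \<longleftrightarrow>
     (\<exists>\<omega> :: real ^ 'a \<Rightarrow> real.
        T = {fst ` F | F. lower_face F (convex hull ((\<lambda>v. (v, \<omega> v)) ` lattice_points Q))})"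

text \<open>
  The coefficient functions are taken from \<open>\<rightarrow>\<^sub>E\<close> so that uniqueness refers to their values on \<open>B\<close>.
\<close>

definition integer_basis :: "'b::real_vector set \<Rightarrow> 'b set \<Rightarrow> bool" where
  "integer_basis B L \<longleftrightarrow>
     finite B \<and> B \<subseteq> L \<and>
     (\<forall>z\<in>L. \<exists>!c :: 'b \<Rightarrow> int. c \<in> B \<rightarrow>\<^sub>E UNIV \<and> z = (\<Sum>b\<in>B. of_int (c b) *\<^sub>R b))"

definition unimodular_simplex :: "'a::finite set \<Rightarrow> (real ^ 'a) set \<Rightarrow> bool" where
  "unimodular_simplex P S \<longleftrightarrow>
     int (card P) simplex S \<and>
     (\<forall>v \<in> vertices S.
        integer_basis ((\<lambda>w. w - v) ` (vertices S - {v})) (lattice_points (coord_space P)))"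

definition unimodular_triangulation :: "'a::finite set \<Rightarrow> (real ^ 'a) set set \<Rightarrow> bool" where
  "unimodular_triangulation P T \<longleftrightarrow>
     (\<forall>S\<in>T. (\<forall>S'\<in>T. S \<subseteq> S' \<longrightarrow> S' = S) \<longrightarrow> unimodular_simplex P S)"

definition underlying_complex :: "'b::real_vector set set \<Rightarrow> 'b set set" where
  "underlying_complex T = vertices ` T"

definition flag_complex :: "'b set set \<Rightarrow> bool" where
  "flag_complex K \<longleftrightarrow>
     (\<forall>W. W \<subseteq> \<Union>K \<and> W \<notin> K \<and> (\<forall>W'. W' \<subset> W \<longrightarrow> W' \<in> K) \<longrightarrow> card W = 2)"

end

theory Submission
  imports Defs
begin

text \<open>
  The antichains of \<open>P\<close> are the sets of minimal elements of its up-sets. A linear extension, listed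
  from the top, has initial segments \<open>F\<^sub>0 \<subset> \<dots> \<subset> F\<^sub>n\<close> that form a maximal chain of up-sets, and
  the vectors \<open>rho F\<^sub>k\<close> span a simplex. These simplices are the images of the cells of the order
  polytope under Stanley's transfer map; its inverse \<open>v \<mapsto> u\<close>, where \<open>u x\<close> is the largest sum of
  \<open>v\<close> over a chain below \<open>x\<close>, is convex in each coordinate. Hence \<open>\<Sum>x y. max (u x) (u y)\<close> is convex,
  and its domains of linearity are exactly these simplices: it is the height function, and a linear
  minorant that is sharp on one simplex is obtained by fixing a chain below each \<open>x\<close> and the larger
  entry of each pair. The faces correspond to the chains of up-sets, which gives flagness.
\<close>

section \<open>Cells of regular subdivisions\<close>

text \<open>Lower faces, seen on the finite set of lifted points instead of its hull. The factor
  \<open>t\<close> is kept to match \<open>lower_face\<close>; a strict lower bound \<open>b\<close>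
  gives the empty cell.\<close>

definition regular_cell :: "('b::euclidean_space \<Rightarrow> real) \<Rightarrow> 'b set \<Rightarrow> 'b set \<Rightarrow> bool" where
  "regular_cell \<omega> V S \<longleftrightarrow> (\<exists>c t b. 0 < t \<and> (\<forall>v\<in>V. b \<le> inner c v + t * \<omega> v) \<and>
     S = {v \<in> V. inner c v + t * \<omega> v = b})"

text \<open>A face of a polytope is the hull of the generators lying on it, and the projection
  \<open>fst\<close>, being linear, commutes with hulls.\<close>

lemma fst_lower_face_convex_hull:
  fixes \<omega> :: "'b::euclidean_space \<Rightarrow> real"
  assumes "finite V" and ge: "\<And>v. v \<in> V \<Longrightarrow> b \<le> inner c v + t * \<omega> v"
  shows "fst ` {p \<in> convex hull ((\<lambda>v. (v, \<omega> v)) ` V). inner (c, t) p = b} =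
    convex hull {v \<in> V. inner c v + t * \<omega> v = b}"
proof -
  let ?lift = "\<lambda>v. (v, \<omega> v)"
  let ?K = "convex hull (?lift ` V)"
  let ?F = "{p \<in> ?K. inner (c, t) p = b}"
  let ?S = "{v \<in> V. inner c v + t * \<omega> v = b}"
  have "?K \<subseteq> {p. inner (c, t) p \<ge> b}"
    using ge by (intro hull_minimal convex_halfspace_ge) auto
  then have "?F face_of ?K"
    using face_of_Int_supporting_hyperplane_ge[of ?K b "(c, t)"] by (auto simp: Int_def)
  then obtain T where T: "T \<subseteq> ?lift ` V" "?F = convex hull T"
    using face_of_convex_hull_subset[of "?lift ` V" ?F] assms(1)
    by (auto intro: finite_imp_compact)
  have "T \<subseteq> ?F" using T(2) by (simp add: hull_subset)
  then have "T \<subseteq> ?lift ` ?S" using T(1) by fastforce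
  moreover have "?lift ` ?S \<subseteq> ?F" by (auto intro: hull_inc)
  ultimately have "?F = convex hull (?lift ` ?S)"
    unfolding T(2) by (metis (no_types, lifting) convex_convex_hull hull_minimal hull_mono subset_antisym)
  then have "fst ` ?F = convex hull (fst ` ?lift ` ?S)"
    using convex_hull_linear_image[OF linear_fst, of "?lift ` ?S"] by simp
  then show ?thesis by (simp add: image_image)
qed

text \<open>Reduces regularity to finite sets: a linear inequality holds on a hull as soon as it
  holds on the generators.\<close>

lemma lower_faces_convex_hull:
  fixes \<omega> :: "'b::euclidean_space \<Rightarrow> real"
  assumes "finite V"
  shows "{fst ` F | F. lower_face F (convex hull ((\<lambda>v. (v, \<omega> v)) ` V))} =
    (hull) convex ` {S. regular_cell \<omega> V S}" (is "?L = ?R")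
proof -
  let ?lift = "\<lambda>v. (v, \<omega> v)"
  have bound: "(\<forall>p\<in>convex hull (?lift ` V). b \<le> inner (c, t) p) \<longleftrightarrow>
      (\<forall>v\<in>V. b \<le> inner c v + t * \<omega> v)" (is "?A \<longleftrightarrow> ?B") for b c t
  proof
    assume ?A
    show ?B
    proof
      fix v assume "v \<in> V"
      then have "?lift v \<in> convex hull (?lift ` V)" by (intro hull_inc) auto
      then show "b \<le> inner c v + t * \<omega> v" using \<open>?A\<close> by fastforce
    qed
  next
    assume ?B
    then have "convex hull (?lift ` V) \<subseteq> {p. inner (c, t) p \<ge> b}"
      by (intro hull_minimal convex_halfspace_ge) auto
    then show ?A by blast
  qed
  show ?thesis
  proof (intro equalityI subsetI)
    fix X assume "X \<in> ?L"
    then obtain c t b where *: "0 < t" "\<forall>v\<in>V. b \<le> inner c v + t * \<omega> v"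
        "X = fst ` {p \<in> convex hull (?lift ` V). inner (c, t) p = b}"
      unfolding lower_face_def bound by blast
    then have "X = convex hull {v \<in> V. inner c v + t * \<omega> v = b}"
      using fst_lower_face_convex_hull[OF assms] by simp
    moreover have "regular_cell \<omega> V {v \<in> V. inner c v + t * \<omega> v = b}"
      using * unfolding regular_cell_def by blast
    ultimately show "X \<in> ?R" by blast
  next
    fix X assume "X \<in> ?R"
    then obtain c t b where *: "0 < t" "\<forall>v\<in>V. b \<le> inner c v + t * \<omega> v"
        "X = convex hull {v \<in> V. inner c v + t * \<omega> v = b}"
      unfolding regular_cell_def by blast
    then have "X = fst ` {p \<in> convex hull (?lift ` V). inner (c, t) p = b}"
      using fst_lower_face_convex_hull[OF assms, of b c t \<omega>] by simp
    moreover have "lower_face {p \<in> convex hull (?lift ` V). inner (c, t) p = b}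
        (convex hull (?lift ` V))"
      unfolding lower_face_def bound using *(1,2) by blast
    ultimately show "X \<in> ?L" by blast
  qed
qed

text \<open>A point of a cell has minimal height among all convex combinations that represent it, and
  the weights of a representation of minimal height vanish off the cell.\<close>

lemma regular_cell_support:
  fixes \<omega> :: "'b::euclidean_space \<Rightarrow> real"
  assumes cell: "regular_cell \<omega> V S" "regular_cell \<omega> V S'" and fin: "finite V"
    and u: "\<And>v. v \<in> S \<Longrightarrow> 0 \<le> u v" "sum u S = 1"
    and u': "\<And>v. v \<in> S' \<Longrightarrow> 0 \<le> u' v" "sum u' S' = 1"
    and eq: "(\<Sum>v\<in>S. u v *\<^sub>R v) = (\<Sum>v\<in>S'. u' v *\<^sub>R v)"
    and v: "v \<in> S'" "u' v \<noteq> 0"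
  shows "v \<in> S"
proof -
  \<comment> \<open>Stated for arbitrary cells and weights, so that exchanging the two roles yields
    equality of the two heights.\<close>
  have le: "(\<Sum>v\<in>S. u v * \<omega> v) \<le> (\<Sum>v\<in>S'. u' v * \<omega> v) \<and>
      ((\<Sum>v\<in>S. u v * \<omega> v) = (\<Sum>v\<in>S'. u' v * \<omega> v) \<longrightarrow> (\<forall>v\<in>S'. u' v \<noteq> 0 \<longrightarrow> v \<in> S))"
    if cell: "regular_cell \<omega> V S" "regular_cell \<omega> V S'"
      and u: "\<And>v. v \<in> S \<Longrightarrow> 0 \<le> u v" "sum u S = 1"
      and u': "\<And>v. v \<in> S' \<Longrightarrow> 0 \<le> u' v" "sum u' S' = 1"
      and eq: "(\<Sum>v\<in>S. u v *\<^sub>R v) = (\<Sum>v\<in>S'. u' v *\<^sub>R v)" for u u' and S S' :: "'b set"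
  proof -
    obtain c t b where S: "0 < t" "\<And>v. v \<in> V \<Longrightarrow> b \<le> inner c v + t * \<omega> v"
        "S = {v \<in> V. inner c v + t * \<omega> v = b}"
      using cell(1) unfolding regular_cell_def by blast
    have S': "S' \<subseteq> V" using cell(2) unfolding regular_cell_def by blast
    have "finite S'" using S' fin finite_subset by blast
    have expand: "(\<Sum>v\<in>A. w v * (inner c v + t * \<omega> v - b)) =
        inner c (\<Sum>v\<in>A. w v *\<^sub>R v) + t * (\<Sum>v\<in>A. w v * \<omega> v) - b * sum w A" for w A
      by (simp add: inner_sum_right sum.distrib sum_subtractf sum_distrib_left algebra_simps)
    \<comment> \<open>The slack over the hyperplane vanishes on \<open>S\<close>. Both
      representations have the same point and total weight, so the weighted slack on
      \<open>S'\<close> is \<open>t\<close> times the difference of heights.\<close>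
    have "(\<Sum>v\<in>S. u v * (inner c v + t * \<omega> v - b)) = 0"
      using S(3) by (intro sum.neutral) auto
    then have *: "(\<Sum>v\<in>S'. u' v * (inner c v + t * \<omega> v - b)) =
        t * ((\<Sum>v\<in>S'. u' v * \<omega> v) - (\<Sum>v\<in>S. u v * \<omega> v))"
      unfolding expand eq u(2) u'(2) by (simp add: algebra_simps)
    have nonneg: "0 \<le> u' v * (inner c v + t * \<omega> v - b)" if "v \<in> S'" for v
      using u'(1)[OF that] S(2)[of v] that S' by auto
    have "0 \<le> t * ((\<Sum>v\<in>S'. u' v * \<omega> v) - (\<Sum>v\<in>S. u v * \<omega> v))"
      unfolding *[symmetric] using nonneg by (rule sum_nonneg)
    moreover have "\<forall>v\<in>S'. u' v \<noteq> 0 \<longrightarrow> v \<in> S"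
      if "(\<Sum>v\<in>S. u v * \<omega> v) = (\<Sum>v\<in>S'. u' v * \<omega> v)"
    proof -
      have "\<forall>v\<in>S'. u' v * (inner c v + t * \<omega> v - b) = 0"
        using * that sum_nonneg_eq_0_iff[OF \<open>finite S'\<close> nonneg] by simp
      then show ?thesis using S(3) S' by auto
    qed
    ultimately show ?thesis using S(1) by (simp add: zero_le_mult_iff)
  qed
  have "(\<Sum>v\<in>S. u v * \<omega> v) = (\<Sum>v\<in>S'. u' v * \<omega> v)"
    using le[OF cell u u' eq] le[OF cell(2,1) u' u eq[symmetric]] by (meson antisym)
  with le[OF cell u u' eq] v show ?thesis by blast
qed

text \<open>By \<open>regular_cell_support\<close>, the weights that represent a common point over
  \<open>S'\<close> vanish off \<open>S\<close>, so they already represent it over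
  \<open>S \<inter> S'\<close>.\<close>

lemma regular_cell_Int:
  fixes \<omega> :: "'b::euclidean_space \<Rightarrow> real"
  assumes cell: "regular_cell \<omega> V S" "regular_cell \<omega> V S'" and fin: "finite V"
  shows "convex hull S \<inter> convex hull S' = convex hull (S \<inter> S')"
proof (intro equalityI subsetI)
  fix p assume p: "p \<in> convex hull S \<inter> convex hull S'"
  have "S \<subseteq> V" "S' \<subseteq> V" using cell unfolding regular_cell_def by auto
  then have fins: "finite S" "finite S'" using fin finite_subset by auto
  obtain u where u: "\<And>v. v \<in> S \<Longrightarrow> 0 \<le> u v" "sum u S = 1" "(\<Sum>v\<in>S. u v *\<^sub>R v) = p"
    using p fins by (auto simp: convex_hull_finite)
  obtain u' where u': "\<And>v. v \<in> S' \<Longrightarrow> 0 \<le> u' v" "sum u' S' = 1" "(\<Sum>v\<in>S'. u' v *\<^sub>R v) = p"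
    using p fins by (auto simp: convex_hull_finite)
  have supp: "u' v = 0" if "v \<in> S'" "v \<notin> S" for v
    using regular_cell_support[OF cell fin u(1,2) u'(1,2)] u(3) u'(3) that by metis
  have "sum u' (S \<inter> S') = 1"
    using u'(2) sum.mono_neutral_left[of S' "S \<inter> S'" u'] fins supp by auto
  moreover have "(\<Sum>v\<in>S \<inter> S'. u' v *\<^sub>R v) = p"
    using u'(3) sum.mono_neutral_left[of S' "S \<inter> S'" "\<lambda>v. u' v *\<^sub>R v"] fins supp by auto
  ultimately show "p \<in> convex hull (S \<inter> S')"
    using u'(1) fins by (auto simp: convex_hull_finite)
next
  fix p assume "p \<in> convex hull (S \<inter> S')"
  then show "p \<in> convex hull S \<inter> convex hull S'" by (meson IntI Int_lower1 Int_lower2 hull_mono in_mono)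
qed

section \<open>Subsets of affinely independent cells\<close>

text \<open>Moving one point \<open>a\<close> to the origin makes the other points linearly
  independent, so the prescribed values extend to a linear functional; \<open>k\<close> restores the
  value at \<open>a\<close>.\<close>

lemma affine_independent_interpolation:
  fixes S :: "'b::euclidean_space set"
  assumes "\<not> affine_dependent S"
  obtains l k where "\<And>v. v \<in> S \<Longrightarrow> inner l v + k = f v"
proof (cases "S = {}")
  case False
  then obtain a where a: "a \<in> S" by blast
  have "independent ((\<lambda>x. - a + x) ` (S - {a}))"
    using assms affine_dependent_iff_dependent2[OF a] by simp
  from linear_independent_extend[OF this, of "\<lambda>x. f (x + a) - f a"]
  obtain g :: "'b \<Rightarrow> real" where g: "linear g"
      "\<And>x. x \<in> (\<lambda>x. - a + x) ` (S - {a}) \<Longrightarrow> g x = f (x + a) - f a" by blast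
  \<comment> \<open>The vector that represents the functional \<open>g\<close> as an inner
    product.\<close>
  define l where "l = adjoint g 1"
  have l: "inner l x = g x" for x
    using adjoint_works[OF g(1), of x 1] by (simp add: l_def inner_commute)
  have "inner l v + (f a - inner l a) = f v" if "v \<in> S" for v
  proof (cases "v = a")
    case False
    then have "inner l (- a + v) = f v - f a" using that unfolding l by (subst g(2)) auto
    then show ?thesis by (simp add: inner_add_right inner_diff_right)
  qed simp
  then show ?thesis using that by blast
qed (use that in blast)

text \<open>Tilting: an affine function that is 0 on \<open>S'\<close> and 1 on
  \<open>S - S'\<close> is added to a large multiple of the slack of \<open>S\<close>. On
  \<open>S\<close> only the tilt is seen; off \<open>S\<close> the positive slack dominates
  it.\<close>

lemma regular_cell_subset:
  fixes \<omega> :: "'b::euclidean_space \<Rightarrow> real"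
  assumes cell: "regular_cell \<omega> V S" and fin: "finite V"
    and indep: "\<not> affine_dependent S" and S': "S' \<subseteq> S"
  shows "regular_cell \<omega> V S'"
proof -
  obtain c t b where S: "0 < t" "\<And>v. v \<in> V \<Longrightarrow> b \<le> inner c v + t * \<omega> v"
      "S = {v \<in> V. inner c v + t * \<omega> v = b}"
    using cell(1) unfolding regular_cell_def by blast
  obtain l k where lk: "\<And>v. v \<in> S \<Longrightarrow> inner l v + k = of_bool (v \<notin> S')"
    using affine_independent_interpolation[OF indep, of "\<lambda>v. of_bool (v \<notin> S')"] by blast
  define \<delta> where "\<delta> v = inner c v + t * \<omega> v - b" for v
  define m where "m v = inner l v + k" for v
  \<comment> \<open>\<open>T\<close> exceeds each ratio of \<open>\<bar>m v\<bar>\<close> to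
    \<open>\<delta> v\<close>; the summand 1 makes the bound strict and keeps \<open>T\<close>
    positive if \<open>V = S\<close>.\<close>
  define T where "T = 1 + (\<Sum>v\<in>V - S. \<bar>m v\<bar> / \<delta> v)"
  have pos: "0 < \<delta> v" if "v \<in> V - S" for v using S(2)[of v] S(3) that by (auto simp: \<delta>_def)
  have "0 \<le> (\<Sum>v\<in>V - S. \<bar>m v\<bar> / \<delta> v)"
    using pos by (intro sum_nonneg divide_nonneg_nonneg) (auto simp: less_imp_le)
  then have T: "0 < T" by (simp add: T_def)
  have big: "0 < T * \<delta> v + m v" if v: "v \<in> V - S" for v
  proof -
    have "\<bar>m v\<bar> / \<delta> v \<le> (\<Sum>v\<in>V - S. \<bar>m v\<bar> / \<delta> v)"
      using pos v fin by (intro member_le_sum divide_nonneg_nonneg) (auto simp: less_imp_le)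
    then have "\<bar>m v\<bar> / \<delta> v < T" by (simp add: T_def)
    then have "\<bar>m v\<bar> < T * \<delta> v" using pos[OF v] by (simp add: divide_less_eq)
    then show ?thesis by linarith
  qed
  have on: "T * \<delta> v + m v = of_bool (v \<notin> S')" if "v \<in> S" for v
    using that lk S(3) by (auto simp: \<delta>_def m_def)
  have eq: "inner (T *\<^sub>R c + l) v + (T * t) * \<omega> v - (T * b - k) = T * \<delta> v + m v" for v
    by (simp add: \<delta>_def m_def inner_add_left algebra_simps)
  have sign: "0 \<le> T * \<delta> v + m v" "T * \<delta> v + m v = 0 \<longleftrightarrow> v \<in> S'" if "v \<in> V" for v
    using big[of v] on[of v] that S' by (cases "v \<in> S"; auto)+
  have "S' \<subseteq> V" using S' S(3) by blast
  have "0 < T * t" using T S(1) by simp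
  moreover have "\<forall>v\<in>V. T * b - k \<le> inner (T *\<^sub>R c + l) v + (T * t) * \<omega> v"
    using sign(1) unfolding eq[symmetric] by auto
  moreover have "S' = {v \<in> V. inner (T *\<^sub>R c + l) v + (T * t) * \<omega> v = T * b - k}"
    using sign(2) \<open>S' \<subseteq> V\<close> unfolding eq[symmetric] by auto
  ultimately show ?thesis unfolding regular_cell_def by blast
qed

section \<open>Lattice bases from the edges of a simplex\<close>

text \<open>A combination of the points with total weight 0 is a combination of the edges at
  \<open>v\<close>. Uniqueness is the linear independence of these edges.\<close>

lemma integer_basis_edges:
  fixes S L :: "'b::euclidean_space set"
  assumes indep: "\<not> affine_dependent S" and "0 \<in> S" and v: "v \<in> S"
    and L: "\<And>w. w \<in> S \<Longrightarrow> w - v \<in> L"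
    and span: "\<And>z. z \<in> L \<Longrightarrow> \<exists>c :: 'b \<Rightarrow> int. z = (\<Sum>s\<in>S. of_int (c s) *\<^sub>R s)"
  shows "integer_basis ((\<lambda>w. w - v) ` (S - {v})) L"
proof -
  let ?B = "(\<lambda>w. w - v) ` (S - {v})"
  have fin: "finite S" using indep aff_independent_finite by blast
  have ind: "independent ?B"
    using indep affine_dependent_iff_dependent2[OF v] by simp
  have "\<exists>!c :: 'b \<Rightarrow> int. c \<in> ?B \<rightarrow>\<^sub>E UNIV \<and> z = (\<Sum>b\<in>?B. of_int (c b) *\<^sub>R b)" if z: "z \<in> L" for z
  proof (rule ex_ex1I)
    obtain c :: "'b \<Rightarrow> int" where c: "z = (\<Sum>s\<in>S. of_int (c s) *\<^sub>R s)" using span[OF z] by blast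
    \<comment> \<open>The coefficient of \<open>0 \<in> S\<close> is free; it is chosen so that the coefficients sum to 0.\<close>
    define d where "d = c(0 := c 0 - sum c S)"
    have "sum d S = 0"
      using fin \<open>0 \<in> S\<close> by (simp add: d_def sum.remove[of S 0])
    then have "(\<Sum>s\<in>S. real_of_int (d s)) = 0" by (metis of_int_0 of_int_sum)
    then have "(\<Sum>s\<in>S. of_int (d s) *\<^sub>R v) = 0" by (simp flip: scaleR_left.sum)
    moreover have "z = (\<Sum>s\<in>S. of_int (d s) *\<^sub>R s)"
      unfolding c by (intro sum.cong) (auto simp: d_def)
    ultimately have "z = (\<Sum>s\<in>S. of_int (d s) *\<^sub>R (s - v))"
      by (simp add: scaleR_diff_right sum_subtractf)
    also have "\<dots> = (\<Sum>s\<in>S - {v}. of_int (d s) *\<^sub>R (s - v))"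
      using fin v by (simp add: sum.remove)
    also have "\<dots> = (\<Sum>b\<in>?B. of_int (d (b + v)) *\<^sub>R b)"
      by (subst sum.reindex) (auto simp: inj_on_def)
    finally show "\<exists>c :: 'b \<Rightarrow> int. c \<in> ?B \<rightarrow>\<^sub>E UNIV \<and> z = (\<Sum>b\<in>?B. of_int (c b) *\<^sub>R b)"
      by (intro exI[of _ "restrict (\<lambda>b. d (b + v)) ?B"]) (auto intro!: sum.cong)
  next
    fix c d :: "'b \<Rightarrow> int"
    assume c: "c \<in> ?B \<rightarrow>\<^sub>E UNIV \<and> z = (\<Sum>b\<in>?B. of_int (c b) *\<^sub>R b)"
      and d: "d \<in> ?B \<rightarrow>\<^sub>E UNIV \<and> z = (\<Sum>b\<in>?B. of_int (d b) *\<^sub>R b)"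
    then have "(\<Sum>b\<in>?B. (of_int (c b) - of_int (d b)) *\<^sub>R b) = 0"
      by (simp add: scaleR_left_diff_distrib sum_subtractf)
    then have "real_of_int (c b) - of_int (d b) = 0" if "b \<in> ?B" for b
      using independentD[OF ind, of ?B "\<lambda>b. of_int (c b) - of_int (d b)" b] fin that by blast
    then have "c b = d b" if "b \<in> ?B" for b using that by fastforce
    then show "c = d" using c d by (meson PiE_ext)
  qed
  then show ?thesis unfolding integer_basis_def using fin L by auto
qed

section \<open>Integer combinations\<close>

definition int_combinations :: "'b::real_vector set \<Rightarrow> 'b set" where
  "int_combinations S = {z. \<exists>c :: 'b \<Rightarrow> int. z = (\<Sum>s\<in>S. of_int (c s) *\<^sub>R s)}"

lemma int_combinations_base:
  assumes "finite S" "x \<in> S"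
  shows "x \<in> int_combinations S"
proof -
  have "(\<Sum>s\<in>S. of_int (of_bool (s = x)) *\<^sub>R s) = (\<Sum>s\<in>S. if s = x then s else 0)"
    by (intro sum.cong) auto
  also have "\<dots> = x" using assms by simp
  finally have "x = (\<Sum>s\<in>S. of_int (of_bool (s = x)) *\<^sub>R s)" by simp
  then show ?thesis unfolding int_combinations_def
    by (intro CollectI exI[of _ "\<lambda>s. of_bool (s = x)"])
qed

lemma int_combinations_diff:
  assumes "x \<in> int_combinations S" "y \<in> int_combinations S"
  shows "x - y \<in> int_combinations S"
proof -
  obtain c d :: "'a \<Rightarrow> int" where "x = (\<Sum>s\<in>S. of_int (c s) *\<^sub>R s)" "y = (\<Sum>s\<in>S. of_int (d s) *\<^sub>R s)"
    using assms unfolding int_combinations_def by blast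
  then have "x - y = (\<Sum>s\<in>S. of_int (c s - d s) *\<^sub>R s)"
    by (simp add: sum_subtractf scaleR_left_diff_distrib)
  then show ?thesis unfolding int_combinations_def by (intro CollectI exI[of _ "\<lambda>s. c s - d s"])
qed

lemma int_combinations_sum:
  assumes "\<And>i. i \<in> I \<Longrightarrow> f i \<in> int_combinations S"
  shows "(\<Sum>i\<in>I. of_int (k i) *\<^sub>R f i) \<in> int_combinations S"
proof -
  obtain c :: "_ \<Rightarrow> _ \<Rightarrow> int" where c: "\<And>i. i \<in> I \<Longrightarrow> f i = (\<Sum>s\<in>S. of_int (c i s) *\<^sub>R s)"
    using assms unfolding int_combinations_def mem_Collect_eq by metis
  have "(\<Sum>i\<in>I. of_int (k i) *\<^sub>R f i) = (\<Sum>i\<in>I. \<Sum>s\<in>S. of_int (k i * c i s) *\<^sub>R s)"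
    by (intro sum.cong) (simp_all add: c scaleR_sum_right)
  also have "\<dots> = (\<Sum>s\<in>S. of_int (\<Sum>i\<in>I. k i * c i s) *\<^sub>R s)"
    by (subst sum.swap) (simp add: scaleR_left.sum)
  finally show ?thesis unfolding int_combinations_def
    by (intro CollectI exI[of _ "\<lambda>s. \<Sum>i\<in>I. k i * c i s"])
qed

section \<open>Up-sets and linear extensions of a finite poset\<close>

locale finite_poset =
  fixes P :: "'a::finite set" and r :: "'a rel"
  assumes partial_order: "partial_order_on P r"
begin

lemma le_refl: "x \<in> P \<Longrightarrow> (x, x) \<in> r"
  using partial_order by (auto simp: partial_order_on_def preorder_on_def refl_on_def)

lemma le_trans: "(x, y) \<in> r \<Longrightarrow> (y, z) \<in> r \<Longrightarrow> (x, z) \<in> r"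
  using partial_order by (auto simp: partial_order_on_def preorder_on_def elim: transE)

lemma le_antisym: "(x, y) \<in> r \<Longrightarrow> (y, x) \<in> r \<Longrightarrow> x = y"
  using partial_order by (auto simp: partial_order_on_def elim: antisymD)

definition up_sets :: "'a set set" where
  "up_sets = {F. F \<subseteq> P \<and> (\<forall>x\<in>F. \<forall>y\<in>P. (x, y) \<in> r \<longrightarrow> y \<in> F)}"

definition min_elems :: "'a set \<Rightarrow> 'a set" where
  "min_elems F = {x \<in> F. \<forall>y\<in>F. (y, x) \<in> r \<longrightarrow> y = x}"

text \<open>Lattice points are indexed by up-sets rather than by antichains, since inclusion of
  up-sets is what describes the simplices.\<close>

definition rho :: "'a set \<Rightarrow> real ^ 'a" where
  "rho F = (\<chi> x. of_bool (x \<in> min_elems F))"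

text \<open>The left inverse of \<open>rho\<close> on up-sets.\<close>

definition up_closure :: "real ^ 'a \<Rightarrow> 'a set" where
  "up_closure v = {x \<in> P. \<exists>y\<in>P. v $ y = 1 \<and> (y, x) \<in> r}"

definition is_chain :: "'a set \<Rightarrow> bool" where
  "is_chain C \<longleftrightarrow> C \<subseteq> P \<and> (\<forall>x\<in>C. \<forall>y\<in>C. (x, y) \<in> r \<or> (y, x) \<in> r)"

text \<open>The direction is chosen so that prefixes are up-sets: no entry lies below a later
  one.\<close>

definition linear_extension :: "'a list \<Rightarrow> bool" where
  "linear_extension xs \<longleftrightarrow>
     distinct xs \<and> set xs = P \<and> sorted_wrt (\<lambda>x y. (x, y) \<notin> r) xs"

lemma rho_nth [simp]: "rho F $ x = of_bool (x \<in> min_elems F)"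
  by (simp add: rho_def)

lemma minimal_element_exists:
  assumes "S \<subseteq> P" "S \<noteq> {}"
  obtains m where "m \<in> S" "\<And>y. y \<in> S \<Longrightarrow> (y, m) \<in> r \<Longrightarrow> y = m"
proof -
  have "finite S" by simp
  then have "S \<subseteq> P \<longrightarrow> S \<noteq> {} \<longrightarrow> (\<exists>m\<in>S. \<forall>y\<in>S. (y, m) \<in> r \<longrightarrow> y = m)"
  proof (induction S rule: finite_psubset_induct)
    case (psubset A)
    show ?case
    proof (intro impI)
      assume A: "A \<subseteq> P" "A \<noteq> {}"
      then obtain a where a: "a \<in> A" by blast
      let ?B = "{y \<in> A. (y, a) \<in> r \<and> y \<noteq> a}"
      show "\<exists>m\<in>A. \<forall>y\<in>A. (y, m) \<in> r \<longrightarrow> y = m"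
      proof (cases "?B = {}")
        case True then show ?thesis using a by blast
      next
        case False
        have "?B \<subset> A" using a by blast
        then obtain m where m: "m \<in> ?B" "\<forall>y\<in>?B. (y, m) \<in> r \<longrightarrow> y = m"
          using psubset.IH[of ?B] False A by blast
        have "y = m" if "y \<in> A" "(y, m) \<in> r" for y
          using m that le_trans le_antisym by blast
        then show ?thesis using m by blast
      qed
    qed
  qed
  then show ?thesis using that assms by blast
qed

lemma maximal_element_exists:
  assumes "S \<subseteq> P" "S \<noteq> {}"
  obtains m where "m \<in> S" "\<And>y. y \<in> S \<Longrightarrow> (m, y) \<in> r \<Longrightarrow> y = m"
proof -
  interpret dual: finite_poset P "r\<inverse>"
    using partial_order by unfold_locales simp
  show ?thesis using dual.minimal_element_exists[OF assms] that by auto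
qed

lemma min_elem_below:
  assumes "F \<subseteq> P" "x \<in> F"
  obtains y where "y \<in> min_elems F" "(y, x) \<in> r"
proof -
  have "{z \<in> F. (z, x) \<in> r} \<subseteq> P" "{z \<in> F. (z, x) \<in> r} \<noteq> {}"
    using assms le_refl by auto
  then obtain m where m: "m \<in> {z \<in> F. (z, x) \<in> r}"
      "\<And>y. y \<in> {z \<in> F. (z, x) \<in> r} \<Longrightarrow> (y, m) \<in> r \<Longrightarrow> y = m"
    by (rule minimal_element_exists) blast
  then have "m \<in> min_elems F" unfolding min_elems_def using le_trans by blast
  then show ?thesis using that m by blast
qed

text \<open>Every element of \<open>F\<close> lies above a minimal one, and \<open>F\<close> is
  closed upwards.\<close>

lemma up_closure_rho:
  assumes "F \<in> up_sets"
  shows "up_closure (rho F) = F"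
proof -
  have F: "F \<subseteq> P" "\<And>x y. x \<in> F \<Longrightarrow> y \<in> P \<Longrightarrow> (x, y) \<in> r \<Longrightarrow> y \<in> F"
    using assms by (auto simp: up_sets_def)
  have "x \<in> F" if "x \<in> P" "y \<in> min_elems F" "(y, x) \<in> r" for x y
    using that F unfolding min_elems_def by blast
  moreover have "\<exists>y\<in>P. y \<in> min_elems F \<and> (y, x) \<in> r" if x: "x \<in> F" for x
  proof -
    obtain y where "y \<in> min_elems F" "(y, x) \<in> r" using min_elem_below[OF F(1) x] .
    moreover from this F(1) have "y \<in> P" by (auto simp: min_elems_def)
    ultimately show ?thesis by blast
  qed
  ultimately show ?thesis using F(1) unfolding up_closure_def by auto
qed

lemma rho_inj: "inj_on rho up_sets"
  by (metis inj_onI up_closure_rho)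

section \<open>Chains and the lattice points of the chain polytope\<close>

lemma is_chain_in_maxchain:
  assumes "is_chain C"
  obtains M where "pred_on.maxchain P (\<lambda>x y. (x, y) \<in> r) M" "C \<subseteq> M"
proof -
  let ?A = "{M. is_chain M \<and> C \<subseteq> M}"
  have "finite ?A" "C \<in> ?A" using assms by auto
  then obtain M where M: "M \<in> ?A" "\<forall>N\<in>?A. M \<subseteq> N \<longrightarrow> M = N"
    using finite_has_maximal2[of ?A C] by auto
  have ch: "pred_on.chain P (\<lambda>x y. (x, y) \<in> r) D \<longleftrightarrow> is_chain D" for D
    unfolding pred_on.chain_def is_chain_def using le_refl by blast
  have "pred_on.maxchain P (\<lambda>x y. (x, y) \<in> r) M"
    unfolding pred_on.maxchain_def ch using M by auto
  then show ?thesis using that M by blast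
qed

lemma maxchain_is_chain:
  "pred_on.maxchain P (\<lambda>x y. (x, y) \<in> r) M \<Longrightarrow> is_chain M"
  unfolding pred_on.maxchain_def pred_on.chain_def is_chain_def using le_refl by blast

text \<open>Coordinates are nonnegative, those outside \<open>P\<close> being 0, so extending a
  chain to a maximal one does not decrease its sum. Singletons and pairs thereby become available as
  test chains.\<close>

lemma chain_polytope_iff:
  "v \<in> chain_polytope P r \<longleftrightarrow> v \<in> coord_space P \<and> (\<forall>i. 0 \<le> v $ i) \<and>
     (\<forall>C. is_chain C \<longrightarrow> (\<Sum>i\<in>C. v $ i) \<le> 1)"
proof
  assume v: "v \<in> chain_polytope P r"
  have nn: "0 \<le> v $ i" for i
    using v by (cases "i \<in> P") (auto simp: chain_polytope_def coord_space_def)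
  have "(\<Sum>i\<in>C. v $ i) \<le> 1" if "is_chain C" for C
  proof -
    obtain M where M: "pred_on.maxchain P (\<lambda>x y. (x, y) \<in> r) M" "C \<subseteq> M"
      using is_chain_in_maxchain[OF \<open>is_chain C\<close>] .
    have "(\<Sum>i\<in>C. v $ i) \<le> (\<Sum>i\<in>M. v $ i)"
      using M nn by (intro sum_mono2) auto
    also have "\<dots> \<le> 1" using v M by (auto simp: chain_polytope_def)
    finally show ?thesis .
  qed
  with v nn show "v \<in> coord_space P \<and> (\<forall>i. 0 \<le> v $ i) \<and>
     (\<forall>C. is_chain C \<longrightarrow> (\<Sum>i\<in>C. v $ i) \<le> 1)"
    by (auto simp: chain_polytope_def)
next
  assume "v \<in> coord_space P \<and> (\<forall>i. 0 \<le> v $ i) \<and>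
     (\<forall>C. is_chain C \<longrightarrow> (\<Sum>i\<in>C. v $ i) \<le> 1)"
  then show "v \<in> chain_polytope P r"
    using maxchain_is_chain by (auto simp: chain_polytope_def)
qed

lemma convex_chain_polytope: "convex (chain_polytope P r)"
proof (rule convexI)
  fix v w :: "real ^ 'a" and a b :: real
  assume v: "v \<in> chain_polytope P r" and w: "w \<in> chain_polytope P r"
    and ab: "0 \<le> a" "0 \<le> b" "a + b = 1"
  have "(\<Sum>i\<in>C. (a *\<^sub>R v + b *\<^sub>R w) $ i) \<le> 1" if C: "is_chain C" for C
  proof -
    have "(\<Sum>i\<in>C. (a *\<^sub>R v + b *\<^sub>R w) $ i) = a * (\<Sum>i\<in>C. v $ i) + b * (\<Sum>i\<in>C. w $ i)"
      by (simp add: sum.distrib sum_distrib_left)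
    also have "\<dots> \<le> a * 1 + b * 1"
      using v w C ab unfolding chain_polytope_iff by (intro add_mono mult_left_mono) auto
    finally show ?thesis using ab by simp
  qed
  then show "a *\<^sub>R v + b *\<^sub>R w \<in> chain_polytope P r"
    using v w ab unfolding chain_polytope_iff by (auto simp: coord_space_def)
qed

lemma card_chain_min_elems_le:
  assumes "is_chain C"
  shows "card (C \<inter> min_elems F) \<le> 1"
proof -
  have "x = y" if "x \<in> C \<inter> min_elems F" "y \<in> C \<inter> min_elems F" for x y
    using that assms unfolding is_chain_def min_elems_def by blast
  then show ?thesis by (simp add: card_le_Suc0_iff_eq)
qed

lemma sum_rho: "(\<Sum>x\<in>C. rho F $ x) = card (C \<inter> min_elems F)"
  by (simp add: of_bool_def sum.If_cases Collect_conj_eq [symmetric])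

text \<open>Integrality and singleton chains force coordinates 0 and 1; two-element chains make the
  positions of the ones incomparable, so these are the minimal elements of their up-closure.
  Conversely, a chain meets an antichain at most once.\<close>

lemma lattice_points_eq: "lattice_points (chain_polytope P r) = rho ` up_sets"
proof (intro equalityI subsetI)
  fix v assume "v \<in> lattice_points (chain_polytope P r)"
  then have v: "v \<in> chain_polytope P r" and int: "\<And>i. v $ i \<in> \<int>"
    by (auto simp: lattice_points_def)
  have nn: "0 \<le> v $ i" and out: "i \<notin> P \<Longrightarrow> v $ i = 0" for i
    using v by (auto simp: chain_polytope_iff coord_space_def)
  have le1: "v $ i + v $ j \<le> 1" if "i \<in> P" "j \<in> P" "i \<noteq> j" "(i, j) \<in> r" for i j
  proof -
    have "is_chain {i, j}" using that le_refl by (auto simp: is_chain_def)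
    then have "(\<Sum>k\<in>{i, j}. v $ k) \<le> 1" using v by (auto simp: chain_polytope_iff)
    then show ?thesis using that by simp
  qed
  have le: "v $ i \<le> 1" if "i \<in> P" for i
  proof -
    have "is_chain {i}" using that le_refl by (auto simp: is_chain_def)
    then have "(\<Sum>k\<in>{i}. v $ k) \<le> 1" using v chain_polytope_iff by blast
    then show ?thesis by simp
  qed
  have bin: "v $ i = 0 \<or> v $ i = 1" for i
  proof (cases "i \<in> P")
    case True
    obtain k where k: "v $ i = of_int k" using int by (auto elim: Ints_cases)
    have "0 \<le> k" "k \<le> 1" using nn[of i] le[OF True] k by auto
    then have "k = 0 \<or> k = 1" by auto
    then show ?thesis using k by auto
  qed (simp add: out)
  let ?F = "up_closure v"
  have "x \<in> min_elems ?F \<longleftrightarrow> v $ x = 1" for x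
  proof
    assume "x \<in> min_elems ?F"
    then show "v $ x = 1" unfolding min_elems_def up_closure_def using le_refl by force
  next
    assume x: "v $ x = 1"
    then have xP: "x \<in> P" using out by force
    \<comment> \<open>Here \<open>z\<close> witnesses that \<open>y\<close> is in the up-closure. A
      two-element chain \<open>z\<close>, \<open>x\<close> would have sum 2, so
      \<open>z = x\<close>, and \<open>y\<close> is squeezed in between.\<close>
    have "y = x" if "z \<in> P" "v $ z = 1" "(z, y) \<in> r" "(y, x) \<in> r" for y z
    proof -
      have "z = x" using le1[OF that(1) xP] x that le_trans by fastforce
      then show ?thesis using that le_antisym by blast
    qed
    then show "x \<in> min_elems ?F" unfolding min_elems_def up_closure_def
      using x xP le_refl by blast
  qed
  then have "rho ?F = v" using bin by (auto simp: vec_eq_iff of_bool_def)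
  moreover have "?F \<in> up_sets" unfolding up_sets_def up_closure_def using le_trans by blast
  ultimately show "v \<in> rho ` up_sets" by force
next
  fix v assume "v \<in> rho ` up_sets"
  then obtain F where F: "F \<in> up_sets" "v = rho F" by blast
  have "v \<in> coord_space P" using F by (auto simp: coord_space_def up_sets_def min_elems_def)
  moreover have "(\<Sum>i\<in>C. v $ i) \<le> 1" if "is_chain C" for C
    using card_chain_min_elems_le[OF that, of F] unfolding F(2) sum_rho by simp
  ultimately have "v \<in> chain_polytope P r" unfolding chain_polytope_iff using F(2) by simp
  then show "v \<in> lattice_points (chain_polytope P r)"
    unfolding lattice_points_def using F(2) by simp
qed

section \<open>Linear extensions, their prefixes and their simplices\<close>

text \<open>The first entry is a maximal element among the maximisers of \<open>u\<close>: by
  monotonicity anything above it would be a maximiser too. Thus ties in \<open>u\<close> are broken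
  by the order.\<close>

lemma linear_extension_exists:
  fixes u :: "'a \<Rightarrow> real"
  assumes mono: "\<And>x y. x \<in> P \<Longrightarrow> y \<in> P \<Longrightarrow> (x, y) \<in> r \<Longrightarrow> u x \<le> u y"
  obtains xs where "linear_extension xs" "sorted_wrt (\<lambda>x y. u y \<le> u x) xs"
proof -
  have "\<exists>xs. distinct xs \<and> set xs = S \<and> sorted_wrt (\<lambda>x y. (x, y) \<notin> r \<and> u y \<le> u x) xs"
    if "S \<subseteq> P" for S
    using finite[of S] that
  proof (induction S rule: finite_psubset_induct)
    case (psubset S)
    show ?case
    proof (cases "S = {}")
      case False
      have fin: "finite (u ` S)" by simp
      let ?M = "{x \<in> S. u x = Max (u ` S)}"
      have "Max (u ` S) \<in> u ` S" using False fin by (intro Max_in) auto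
      then have "?M \<subseteq> P" "?M \<noteq> {}" using psubset.prems by force+
      then obtain m where m: "m \<in> ?M" "\<And>y. y \<in> ?M \<Longrightarrow> (m, y) \<in> r \<Longrightarrow> y = m"
        by (rule maximal_element_exists) blast
      have max: "u y \<le> u m" if "y \<in> S" for y using m that by simp
      have nle: "(m, y) \<notin> r" if "y \<in> S - {m}" for y
      proof
        assume my: "(m, y) \<in> r"
        then have "u m \<le> u y" using mono[of m y] m(1) psubset.prems that by blast
        then have "y \<in> ?M" using m(1) max[of y] that by (auto intro: antisym)
        then show False using m(2)[of y] my that by blast
      qed
      obtain xs where "distinct xs" "set xs = S - {m}"
          "sorted_wrt (\<lambda>x y. (x, y) \<notin> r \<and> u y \<le> u x) xs"
        using psubset.IH[of "S - {m}"] m psubset.prems by blast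
      then show ?thesis using max nle m by (intro exI[of _ "m # xs"]) auto
    qed auto
  qed
  from this[of P] obtain xs where "distinct xs" "set xs = P"
      "sorted_wrt (\<lambda>x y. (x, y) \<notin> r \<and> u y \<le> u x) xs" by blast
  then show ?thesis using that unfolding linear_extension_def
    by (auto intro: sorted_wrt_mono_rel[rotated])
qed

lemma in_set_take_conv_nth:
  "x \<in> set (take k xs) \<longleftrightarrow> (\<exists>i. i < length xs \<and> i < k \<and> x = xs ! i)"
  by (auto simp: in_set_conv_nth)

lemma nth_in_take_iff:
  assumes "linear_extension xs" "i < length xs"
  shows "xs ! i \<in> set (take k xs) \<longleftrightarrow> i < k"
proof -
  have "distinct xs" using assms by (simp add: linear_extension_def)
  then show ?thesis using assms(2) by (auto simp: in_set_conv_nth nth_eq_iff_index_eq)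
qed

lemma take_in_up_sets:
  assumes "linear_extension xs"
  shows "set (take k xs) \<in> up_sets"
proof -
  have xs: "set xs = P" "sorted_wrt (\<lambda>x y. (x, y) \<notin> r) xs"
    using assms by (auto simp: linear_extension_def)
  have "y \<in> set (take k xs)" if x: "x \<in> set (take k xs)" and y: "y \<in> P" "(x, y) \<in> r" for x y
  proof -
    obtain i where i: "i < length xs" "i < k" "x = xs ! i"
      using x unfolding in_set_take_conv_nth by blast
    obtain j where j: "j < length xs" "y = xs ! j"
      using y(1) xs(1) by (auto simp: in_set_conv_nth)
    have "\<not> i < j" using xs(2) i j y(2) sorted_wrt_nth_less by blast
    then show ?thesis using i j nth_in_take_iff[OF assms] by simp
  qed
  moreover have "set (take k xs) \<subseteq> P" using set_take_subset xs(1) by fastforce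
  ultimately show ?thesis unfolding up_sets_def by blast
qed

lemma initial_segment_eq_take:
  assumes "F \<subseteq> set xs"
    and initial: "\<And>i j. i < j \<Longrightarrow> j < length xs \<Longrightarrow> xs ! j \<in> F \<Longrightarrow> xs ! i \<in> F"
  obtains k where "k \<le> length xs" "F = set (take k xs)"
proof -
  define k where "k = length (takeWhile (\<lambda>x. x \<in> F) xs)"
  have take: "take k xs = takeWhile (\<lambda>x. x \<in> F) xs"
    by (simp add: k_def takeWhile_eq_take[symmetric])
  have "xs ! i \<in> set (take k xs)" if "i < length xs" "xs ! i \<in> F" for i
  proof -
    have "i < k"
    proof (rule ccontr)
      assume "\<not> i < k"
      then have "xs ! k \<in> F" using that initial[of k i] by (cases "k = i") auto
      moreover have "xs ! k \<notin> F"
        using \<open>\<not> i < k\<close> that nth_length_takeWhile[of "\<lambda>x. x \<in> F" xs] by (simp add: k_def)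
      ultimately show False by blast
    qed
    then show ?thesis
      using that(1) unfolding in_set_take_conv_nth by blast
  qed
  moreover have "set (take k xs) \<subseteq> F" unfolding take by (auto dest: set_takeWhileD)
  moreover have "\<exists>i<length xs. xs ! i = x" if "x \<in> F" for x
    using assms(1) that by (metis in_set_conv_nth subsetD)
  ultimately have "F = set (take k xs)" by blast
  moreover have "k \<le> length xs" by (simp add: k_def length_takeWhile_le)
  ultimately show ?thesis using that by blast
qed

text \<open>Both ends of the range count: \<open>k = 0\<close> gives the origin, and a linear
  extension yields \<open>card P + 1\<close> vertices.\<close>

definition simplex_vertices :: "'a list \<Rightarrow> (real ^ 'a) set" where
  "simplex_vertices xs = (\<lambda>k. rho (set (take k xs))) ` {..length xs}"

lemma simplex_vertices_subset:
  "linear_extension xs \<Longrightarrow> simplex_vertices xs \<subseteq> lattice_points (chain_polytope P r)"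
  by (auto simp: simplex_vertices_def lattice_points_eq take_in_up_sets)

section \<open>The height function and its supporting functionals\<close>

text \<open>The chain starts at \<open>x\<close> and repeatedly steps to the first listed element
  strictly below. An element is minimal in the prefixes until its successor enters, and then the
  rest of the chain takes over. Since a chain meets an antichain at most once, summing
  \<open>rho\<close> over it gives the indicator of \<open>x\<close> on all prefixes.\<close>

lemma chain_meeting_min_elems:
  assumes xs: "linear_extension xs" and "x \<in> P"
  shows "\<exists>C. is_chain C \<and> (\<forall>y\<in>C. (y, x) \<in> r) \<and>
    (\<forall>k. x \<in> set (take k xs) \<longrightarrow> C \<inter> min_elems (set (take k xs)) \<noteq> {})"
    (is "\<exists>C. ?good x C")
proof (rule ccontr)
  assume "\<not> ?thesis"
  \<comment> \<open>A minimal counterexample \<open>m\<close> is taken, so every element strictly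
    below it has such a chain.\<close>
  then have "{x \<in> P. \<nexists>C. ?good x C} \<subseteq> P" "{x \<in> P. \<nexists>C. ?good x C} \<noteq> {}"
    using assms by auto
  then obtain m where m: "m \<in> {x \<in> P. \<nexists>C. ?good x C}"
      "\<And>y. y \<in> {x \<in> P. \<nexists>C. ?good x C} \<Longrightarrow> (y, m) \<in> r \<Longrightarrow> y = m"
    by (rule minimal_element_exists) blast
  show False
  proof (cases "\<exists>y\<in>P. (y, m) \<in> r \<and> y \<noteq> m")
    case False
    then have "m \<in> min_elems (set (take k xs))" if "m \<in> set (take k xs)" for k
      using that take_in_up_sets[OF xs, of k] unfolding min_elems_def up_sets_def by blast
    then have "?good m {m}" using m(1) le_refl by (auto simp: is_chain_def)
    then show False using m(1) by blast
  next
    case True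
    have P: "set xs = P" using xs by (simp add: linear_extension_def)
    let ?Q = "\<lambda>j. j < length xs \<and> (xs ! j, m) \<in> r \<and> xs ! j \<noteq> m"
    \<comment> \<open>The position of the element strictly below \<open>m\<close> that enters the
      prefixes first; until then \<open>m\<close> itself is minimal.\<close>
    define j where "j = (LEAST j. ?Q j)"
    have "\<exists>j. ?Q j" using True unfolding P[symmetric] by (metis in_set_conv_nth)
    then have j: "?Q j" unfolding j_def by (rule LeastI_ex)
    have least: "j \<le> i" if "?Q i" for i unfolding j_def by (rule Least_le) (rule that)
    have "xs ! j \<in> P" using j P nth_mem by blast
    then obtain C where C: "?good (xs ! j) C" using m(2)[of "xs ! j"] j by blast
    have "?good m (insert m C)"
    proof (intro conjI allI impI)
      have mP: "m \<in> P" using m(1) by blast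
      have "(y, m) \<in> r" if "y \<in> C" for y using C j le_trans that by blast
      then show below: "\<forall>y\<in>insert m C. (y, m) \<in> r" using le_refl[OF mP] by blast
      have "is_chain C" using C by blast
      then show "is_chain (insert m C)" using below mP unfolding is_chain_def by auto
      fix k assume k: "m \<in> set (take k xs)"
      show "insert m C \<inter> min_elems (set (take k xs)) \<noteq> {}"
      proof (cases "xs ! j \<in> set (take k xs)")
        case True
        then show ?thesis using C by blast
      next
        case False
        then have "k \<le> j" using nth_in_take_iff[OF xs] j by simp
        have "y = m" if y: "y \<in> set (take k xs)" "(y, m) \<in> r" for y
        proof (rule ccontr)
          assume "y \<noteq> m"
          obtain i where "i < length xs" "i < k" "y = xs ! i"
            using y(1) unfolding in_set_take_conv_nth by blast
          with least[of i] \<open>y \<noteq> m\<close> y(2) \<open>k \<le> j\<close> show False by simp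
        qed
        then have "m \<in> min_elems (set (take k xs))" using k by (auto simp: min_elems_def)
        then show ?thesis by blast
      qed
    qed
    then show False using m(1) by blast
  qed
qed

text \<open>On a lattice point, this is the sum over all pairs of \<open>max (u x) (u y)\<close>, since \<open>u\<close> is then the
  indicator function of the up-closure.\<close>

definition height :: "real ^ 'a \<Rightarrow> real" where
  "height v = (\<Sum>x\<in>P. \<Sum>y\<in>P. of_bool (x \<in> up_closure v \<or> y \<in> up_closure v))"

text \<open>For each pair, the sum of \<open>rho F\<close> over the chain of the earlier entry is at
  most the indicator of that entry, which is at most the term of the pair in the height. Both bounds
  are sharp on prefixes; an up-set that is no prefix skips an entry before one of its own, and this
  pair has positive slack.\<close>

lemma supporting_functional:
  assumes xs: "linear_extension xs"
  obtains c where
    "\<And>v. v \<in> lattice_points (chain_polytope P r) \<Longrightarrow> 0 \<le> inner c v + height v"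
    "\<And>v. v \<in> lattice_points (chain_polytope P r) \<Longrightarrow>
       inner c v + height v = 0 \<longleftrightarrow> v \<in> simplex_vertices xs"
proof -
  have P: "set xs = P" using xs by (simp add: linear_extension_def)
  have "\<forall>x\<in>P. \<exists>i. i < length xs \<and> xs ! i = x" unfolding P[symmetric] by (simp add: in_set_conv_nth)
  then obtain idx where idx: "\<And>x. x \<in> P \<Longrightarrow> idx x < length xs \<and> xs ! idx x = x" by metis
  have mem_take: "x \<in> set (take k xs) \<longleftrightarrow> idx x < k" if "x \<in> P" for x k
    using nth_in_take_iff[OF xs, of "idx x" k] idx[OF that] by simp
  \<comment> \<open>The larger entry of a pair: a prefix that contains either entry contains the one
    listed earlier.\<close>
  define m where "m x y = (if idx x \<le> idx y then x else y)" for x y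
  have mP: "m x y \<in> P" if "x \<in> P" "y \<in> P" for x y using that by (simp add: m_def)
  obtain C where C: "\<And>x. x \<in> P \<Longrightarrow> is_chain (C x)"
      "\<And>x y. x \<in> P \<Longrightarrow> y \<in> C x \<Longrightarrow> (y, x) \<in> r"
      "\<And>x k. x \<in> P \<Longrightarrow> x \<in> set (take k xs) \<Longrightarrow> C x \<inter> min_elems (set (take k xs)) \<noteq> {}"
    using chain_meeting_min_elems[OF xs] by metis
  define c :: "real ^ 'a" where "c = - (\<Sum>x\<in>P. \<Sum>y\<in>P. \<Sum>z\<in>C (m x y). axis z 1)"
  \<comment> \<open>The slack of one pair. The total is a sum of nonnegative slacks, so it vanishes
    only if each of them does.\<close>
  define d where "d F x y =
      of_bool (x \<in> F \<or> y \<in> F) - real (card (C (m x y) \<inter> min_elems F))" for F x y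
  have eq: "inner c (rho F) + height (rho F) = (\<Sum>x\<in>P. \<Sum>y\<in>P. d F x y)" if "F \<in> up_sets" for F
  proof -
    have "inner c (rho F) = - (\<Sum>x\<in>P. \<Sum>y\<in>P. \<Sum>z\<in>C (m x y). rho F $ z)"
      unfolding c_def
      by (simp add: inner_sum_left inner_axis' del: rho_nth)
    then show ?thesis
      unfolding sum_rho height_def up_closure_rho[OF that] d_def by (simp add: sum_subtractf)
  qed
  have card_le: "card (C x \<inter> min_elems F) \<le> of_bool (x \<in> F)" if "F \<in> up_sets" "x \<in> P" for F x
  proof (cases "x \<in> F")
    case True
    then show ?thesis using card_chain_min_elems_le[OF C(1)[OF that(2)]] by simp
  next
    case False
    have "C x \<inter> min_elems F = {}"
      using C(2)[OF that(2)] that False unfolding up_sets_def min_elems_def by blast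
    then show ?thesis by simp
  qed
  have m_le: "of_bool (m x y \<in> F) \<le> (of_bool (x \<in> F \<or> y \<in> F) :: nat)" for x y F
    by (simp add: m_def)
  have d_nonneg: "0 \<le> d F x y" if "F \<in> up_sets" "x \<in> P" "y \<in> P" for F x y
  proof -
    have "card (C (m x y) \<inter> min_elems F) \<le> of_bool (x \<in> F \<or> y \<in> F)"
      using card_le[OF that(1) mP[OF that(2,3)]] m_le order_trans by blast
    then have "real (card (C (m x y) \<inter> min_elems F)) \<le> real (of_bool (x \<in> F \<or> y \<in> F))"
      by (simp only: of_nat_le_iff)
    then show ?thesis by (simp only: d_def of_nat_of_bool diff_ge_0_iff_ge)
  qed
  have d_take: "d (set (take k xs)) x y = 0" if "x \<in> P" "y \<in> P" for k x y
  proof -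
    let ?F = "set (take k xs)"
    have "x \<in> ?F \<or> y \<in> ?F \<longleftrightarrow> m x y \<in> ?F" using mem_take that by (auto simp: m_def)
    moreover have "card (C (m x y) \<inter> min_elems ?F) = of_bool (m x y \<in> ?F)"
    proof (cases "m x y \<in> ?F")
      case True
      then have "0 < card (C (m x y) \<inter> min_elems ?F)"
        using C(3)[OF mP[OF that]] by (simp add: card_gt_0_iff)
      then show ?thesis
        using True card_le[OF take_in_up_sets[OF xs] mP[OF that], of k] by simp
    next
      case False
      then show ?thesis
        using card_le[OF take_in_up_sets[OF xs] mP[OF that], of k] by simp
    qed
    ultimately show ?thesis by (simp add: d_def)
  qed
  have eq_take: "\<exists>k\<le>length xs. F = set (take k xs)"
    if F: "F \<in> up_sets" and 0: "\<And>x y. x \<in> P \<Longrightarrow> y \<in> P \<Longrightarrow> d F x y = 0" for F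
  proof -
    have "F \<subseteq> set xs" using F P by (auto simp: up_sets_def)
    moreover have "xs ! i \<in> F" if ij: "i < j" "j < length xs" "xs ! j \<in> F" for i j
    proof (rule ccontr)
      assume i: "xs ! i \<notin> F"
      have mem: "xs ! i \<in> P" "xs ! j \<in> P" using ij P nth_mem[of _ xs] by auto
      have "idx (xs ! i) = i" "idx (xs ! j) = j"
        using idx[OF mem(1)] idx[OF mem(2)] xs ij nth_eq_iff_index_eq[of xs]
        by (auto simp: linear_extension_def)
      \<comment> \<open>The chosen chain lies below \<open>xs ! i\<close>, which is missing from
        \<open>F\<close>, so it contributes 0, whereas \<open>xs ! j\<close> makes the pair count in
        the height.\<close>
      then have "m (xs ! i) (xs ! j) = xs ! i" using ij by (simp add: m_def)
      then have "card (C (m (xs ! i) (xs ! j)) \<inter> min_elems F) = 0"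
        using card_le[OF F mem(1)] i by simp
      then have "d F (xs ! i) (xs ! j) = 1" using ij by (simp add: d_def)
      then show False using 0[OF mem] by simp
    qed
    ultimately obtain k where "k \<le> length xs" "F = set (take k xs)"
      by (rule initial_segment_eq_take) blast
    then show ?thesis by blast
  qed
  show ?thesis
  proof
    fix v assume "v \<in> lattice_points (chain_polytope P r)"
    then obtain F where F: "F \<in> up_sets" "v = rho F" unfolding lattice_points_eq by blast
    show "0 \<le> inner c v + height v"
      unfolding F(2) eq[OF F(1)] using d_nonneg[OF F(1)] by (intro sum_nonneg) auto
    have "(\<Sum>x\<in>P. \<Sum>y\<in>P. d F x y) = 0 \<longleftrightarrow> (\<forall>x\<in>P. \<forall>y\<in>P. d F x y = 0)"
      using d_nonneg[OF F(1)] by (simp add: sum_nonneg_eq_0_iff sum_nonneg)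
    also have "\<dots> \<longleftrightarrow> (\<exists>k\<le>length xs. F = set (take k xs))"
      using eq_take[OF F(1)] d_take by blast
    also have "\<dots> \<longleftrightarrow> v \<in> simplex_vertices xs"
      using F take_in_up_sets[OF xs] rho_inj
      by (auto simp: simplex_vertices_def inj_on_eq_iff)
    finally show "inner c v + height v = 0 \<longleftrightarrow> v \<in> simplex_vertices xs"
      unfolding F(2) eq[OF F(1)] .
  qed
qed

section \<open>Decomposition of the points of the chain polytope\<close>

text \<open>The index \<open>m\<close> is that of the first listed element strictly below \<open>xs ! j\<close>, or \<open>length xs\<close> if
  there is none.\<close>

lemma min_elems_take_interval:
  assumes xs: "linear_extension xs" and j: "j < length xs"
  obtains m where "j < m" "m \<le> length xs"
    "\<forall>k\<le>length xs. xs ! j \<in> min_elems (set (take k xs)) \<longleftrightarrow> j < k \<and> k \<le> m"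
    "m < length xs \<longrightarrow> (xs ! m, xs ! j) \<in> r \<and> xs ! m \<noteq> xs ! j"
    "\<forall>i<length xs. (xs ! i, xs ! j) \<in> r \<and> xs ! i \<noteq> xs ! j \<longrightarrow> m \<le> i"
proof -
  define below where "below i \<longleftrightarrow> (xs ! i, xs ! j) \<in> r \<and> xs ! i \<noteq> xs ! j" for i
  define m where "m = (LEAST m. m < length xs \<and> below m \<or> m = length xs)"
  have m: "m < length xs \<and> below m \<or> m = length xs"
    unfolding m_def by (rule LeastI[of _ "length xs"]) simp
  have least: "m \<le> i" if "i < length xs" "below i" for i
    unfolding m_def using that by (intro Least_le) simp
  have jm: "j < m"
  proof (rule ccontr)
    assume "\<not> j < m"
    then have "m < length xs" "below m" using m j by auto
    moreover from this have "m \<noteq> j" by (auto simp: below_def)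
    ultimately show False
      using xs \<open>\<not> j < m\<close> j sorted_wrt_nth_less[of "\<lambda>x y. (x, y) \<notin> r" xs m j]
      by (auto simp: linear_extension_def below_def)
  qed
  have iff: "xs ! j \<in> min_elems (set (take k xs)) \<longleftrightarrow> j < k \<and> k \<le> m" if kn: "k \<le> length xs" for k
  proof
    assume *: "xs ! j \<in> min_elems (set (take k xs))"
    then have "j < k" using nth_in_take_iff[OF xs j] by (simp add: min_elems_def)
    moreover have "k \<le> m"
    proof (rule ccontr)
      assume "\<not> k \<le> m"
      then have mn: "m < length xs" "below m" using m kn by auto
      then have "xs ! m \<in> set (take k xs)" using nth_in_take_iff[OF xs] \<open>\<not> k \<le> m\<close> by simp
      then show False using * mn(2) unfolding min_elems_def below_def by auto
    qed
    ultimately show "j < k \<and> k \<le> m" by simp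
  next
    assume k: "j < k \<and> k \<le> m"
    have "y = xs ! j" if y: "y \<in> set (take k xs)" "(y, xs ! j) \<in> r" for y
    proof (rule ccontr)
      assume "y \<noteq> xs ! j"
      obtain i where "i < length xs" "i < k" "y = xs ! i"
        using y(1) unfolding in_set_take_conv_nth by blast
      then show False using least[of i] y(2) k \<open>y \<noteq> xs ! j\<close> by (simp add: below_def)
    qed
    then show "xs ! j \<in> min_elems (set (take k xs))"
      using k nth_in_take_iff[OF xs j] by (auto simp: min_elems_def)
  qed
  show ?thesis
    using that[OF jm] iff m least unfolding below_def by auto
qed

section \<open>The inverse transfer map\<close>

definition chain_sum :: "real ^ 'a \<Rightarrow> 'a \<Rightarrow> real" where
  "chain_sum v x = Max ((\<lambda>C. \<Sum>y\<in>C. v $ y) ` {C. is_chain C \<and> (\<forall>y\<in>C. (y, x) \<in> r)})"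

lemma chain_sum_ge:
  "is_chain C \<Longrightarrow> (\<And>y. y \<in> C \<Longrightarrow> (y, x) \<in> r) \<Longrightarrow> (\<Sum>y\<in>C. v $ y) \<le> chain_sum v x"
  unfolding chain_sum_def by (intro Max_ge) auto

lemma is_chain_empty: "is_chain {}"
  by (simp add: is_chain_def)

lemma chain_sum_attained:
  obtains C where "is_chain C" "\<And>y. y \<in> C \<Longrightarrow> (y, x) \<in> r" "chain_sum v x = (\<Sum>y\<in>C. v $ y)"
proof -
  have "chain_sum v x \<in> (\<lambda>C. \<Sum>y\<in>C. v $ y) ` {C. is_chain C \<and> (\<forall>y\<in>C. (y, x) \<in> r)}"
    unfolding chain_sum_def using is_chain_empty by (intro Max_in) auto
  then show ?thesis using that by auto
qed

lemma chain_sum_nonneg: "0 \<le> chain_sum v x"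
  using chain_sum_ge[OF is_chain_empty, of x v] by simp

lemma chain_sum_mono: "(x, y) \<in> r \<Longrightarrow> chain_sum v x \<le> chain_sum v y"
  by (metis chain_sum_attained chain_sum_ge le_trans)

text \<open>\<open>x\<close> is put on top of an optimal chain for \<open>y\<close>. With
  \<open>chain_sum_cases\<close> this gives a recursion for nonnegative \<open>v\<close>:
  \<open>v $ x\<close> is the chain sum at \<open>x\<close> minus the largest one strictly below
  \<open>x\<close>, or minus 0 if nothing lies there.\<close>

lemma chain_sum_insert_ge:
  assumes "x \<in> P" "(y, x) \<in> r" "y \<noteq> x"
  shows "v $ x + chain_sum v y \<le> chain_sum v x"
proof -
  obtain C where C: "is_chain C" "\<And>z. z \<in> C \<Longrightarrow> (z, y) \<in> r"
      "chain_sum v y = (\<Sum>z\<in>C. v $ z)" using chain_sum_attained[of y v] by blast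
  have below: "(z, x) \<in> r" if "z \<in> insert x C" for z
    using that C(2) assms le_trans le_refl by blast
  have "x \<notin> C" using C(2) assms le_antisym by blast
  moreover have "is_chain (insert x C)" using C(1) below assms(1) unfolding is_chain_def by auto
  ultimately show ?thesis using chain_sum_ge[of "insert x C" x v] below C(3) by simp
qed

lemma chain_sum_ge_coord: "x \<in> P \<Longrightarrow> v $ x \<le> chain_sum v x"
  using chain_sum_ge[of "{x}" x v] le_refl by (auto simp: is_chain_def)

text \<open>Removing \<open>x\<close> from an optimal chain leaves nothing or a chain whose top
  element lies strictly below \<open>x\<close>.\<close>

lemma chain_sum_cases:
  assumes "x \<in> P" "\<And>i. 0 \<le> v $ i"
  shows "chain_sum v x \<le> v $ x \<or>
    (\<exists>y\<in>P. (y, x) \<in> r \<and> y \<noteq> x \<and> chain_sum v x \<le> v $ x + chain_sum v y)"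
proof -
  obtain C where C: "is_chain C" "\<And>z. z \<in> C \<Longrightarrow> (z, x) \<in> r"
      "chain_sum v x = (\<Sum>z\<in>C. v $ z)" using chain_sum_attained[of x v] by blast
  let ?D = "C - {x}"
  have sum: "chain_sum v x \<le> v $ x + (\<Sum>z\<in>?D. v $ z)"
    using assms(2)[of x] C(3) by (cases "x \<in> C") (auto simp: sum.remove)
  show ?thesis
  proof (cases "?D = {}")
    case True
    then have "chain_sum v x \<le> v $ x" using sum by (metis add_0_right sum.empty)
    then show ?thesis ..
  next
    case False
    have "?D \<subseteq> P" using C(1) by (auto simp: is_chain_def)
    from maximal_element_exists[OF this False]
    obtain m where m: "m \<in> ?D" "\<And>y. y \<in> ?D \<Longrightarrow> (m, y) \<in> r \<Longrightarrow> y = m" by blast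
    have "(z, m) \<in> r" if "z \<in> ?D" for z
      using m that C(1) unfolding is_chain_def by blast
    moreover have "is_chain ?D" using C(1) by (auto simp: is_chain_def)
    ultimately have "(\<Sum>z\<in>?D. v $ z) \<le> chain_sum v m" by (intro chain_sum_ge)
    then have "chain_sum v x \<le> v $ x + chain_sum v m" using sum by simp
    moreover have "m \<in> P" "(m, x) \<in> r" "m \<noteq> x" using m(1) \<open>?D \<subseteq> P\<close> C(2) by auto
    ultimately show ?thesis by blast
  qed
qed

text \<open>When \<open>P\<close> is listed by decreasing chain sums, their successive differences
  are the barycentric coordinates of \<open>v\<close>. For the coordinate \<open>x\<close> they
  telescope over the prefixes in which \<open>x\<close> is minimal, and the recursion for chain sums
  turns the result into \<open>v $ x\<close>.\<close>

lemma chain_polytope_covered: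
  assumes v: "v \<in> chain_polytope P r"
  obtains xs where "linear_extension xs" "v \<in> convex hull simplex_vertices xs"
proof -
  have nonneg: "\<And>i. 0 \<le> v $ i" and out: "\<And>i. i \<notin> P \<Longrightarrow> v $ i = 0"
    using v by (auto simp: chain_polytope_iff coord_space_def)
  obtain xs where xs: "linear_extension xs" "sorted_wrt (\<lambda>x y. chain_sum v y \<le> chain_sum v x) xs"
    using linear_extension_exists[of "chain_sum v"] chain_sum_mono by blast
  have P: "set xs = P" using xs by (simp add: linear_extension_def)
  define n where "n = length xs"
  \<comment> \<open>For \<open>1 \<le> k \<le> n\<close>, \<open>a k\<close> belongs to the entry at
    position \<open>k - 1\<close>; the end values 1 at 0 and 0 at \<open>n + 1\<close> make the
    differences sum to 1.\<close>
  define a where "a k = (if k = 0 then 1 else if k \<le> n then chain_sum v (xs ! (k - 1)) else 0)" for k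
  have le1: "chain_sum v x \<le> 1" for x
    using v chain_sum_attained[of x v] by (metis chain_polytope_iff)
  have decr: "a (Suc k) \<le> a k" if "k \<le> n" for k
  proof (cases "k = 0 \<or> k = n")
    case True
    then show ?thesis using le1 chain_sum_nonneg by (auto simp: a_def)
  next
    case False
    then show ?thesis
      using that sorted_wrt_nth_less[OF xs(2), of "k - 1" k] by (auto simp: a_def n_def)
  qed
  define p where "p k = rho (set (take k xs))" for k
  have "v = (\<Sum>k\<le>n. (a k - a (Suc k)) *\<^sub>R p k)"
  proof (rule vec_eq_iff[THEN iffD2, rule_format])
    fix x
    have sum: "(\<Sum>k\<le>n. (a k - a (Suc k)) *\<^sub>R p k) $ x =
        (\<Sum>k | k \<le> n \<and> x \<in> min_elems (set (take k xs)). a k - a (Suc k))"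
      by (simp add: p_def of_bool_def sum.If_cases if_distrib Int_def cong: if_cong)
    show "v $ x = (\<Sum>k\<le>n. (a k - a (Suc k)) *\<^sub>R p k) $ x"
    proof (cases "x \<in> P")
      case False
      then have "x \<notin> min_elems (set (take k xs))" for k
        using P set_take_subset[of k xs] by (auto simp: min_elems_def)
      then show ?thesis unfolding sum using out[OF False] by simp
    next
      case True
      then obtain j where j: "j < n" "x = xs ! j"
        using P by (auto simp: in_set_conv_nth n_def)
      obtain m where m: "j < m" "m \<le> n"
        "\<forall>k\<le>n. xs ! j \<in> min_elems (set (take k xs)) \<longleftrightarrow> j < k \<and> k \<le> m"
        "m < n \<longrightarrow> (xs ! m, xs ! j) \<in> r \<and> xs ! m \<noteq> xs ! j"
        "\<forall>i<n. (xs ! i, xs ! j) \<in> r \<and> xs ! i \<noteq> xs ! j \<longrightarrow> m \<le> i"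
        by (rule min_elems_take_interval[OF xs(1) j(1)[unfolded n_def], folded n_def])
      have "{k. k \<le> n \<and> x \<in> min_elems (set (take k xs))} = {Suc j..m}"
        using m(2,3) j(2) by auto
      then have "(\<Sum>k\<le>n. (a k - a (Suc k)) *\<^sub>R p k) $ x = (\<Sum>k\<in>{Suc j..m}. a k - a (k + 1))"
        unfolding sum by simp
      also have "\<dots> = a (Suc j) - a (Suc m)"
        unfolding sum_natinterval_diff using m(1) by simp
      also have "\<dots> = chain_sum v x - (if m < n then chain_sum v (xs ! m) else 0)"
        using j m(2) by (auto simp: a_def)
      also have "\<dots> = v $ x"
      proof (rule antisym)
        have "v $ x + (if m < n then chain_sum v (xs ! m) else 0) \<le> chain_sum v x"
          using chain_sum_insert_ge[OF True, of "xs ! m"] chain_sum_ge_coord[OF True] m(4) j(2)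
          by simp
        then show "v $ x \<le> chain_sum v x - (if m < n then chain_sum v (xs ! m) else 0)" by simp
        have "chain_sum v x \<le> v $ x \<or> m < n \<and> chain_sum v x \<le> v $ x + chain_sum v (xs ! m)"
        proof (rule disjE[OF chain_sum_cases[OF True nonneg]])
          assume "\<exists>y\<in>P. (y, x) \<in> r \<and> y \<noteq> x \<and> chain_sum v x \<le> v $ x + chain_sum v y"
          then obtain i where i: "i < n" "(xs ! i, x) \<in> r" "xs ! i \<noteq> x"
              "chain_sum v x \<le> v $ x + chain_sum v (xs ! i)"
            unfolding P[symmetric] n_def by (metis in_set_conv_nth)
          \<comment> \<open>Chain sums decrease along the list, so the first listed element strictly
            below \<open>x\<close> has the largest chain sum among them.\<close>
          have "m \<le> i" using m(5) i j(2) by blast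
          then have "chain_sum v (xs ! i) \<le> chain_sum v (xs ! m)"
            using sorted_wrt_nth_less[OF xs(2), of m i] i(1) by (cases "m = i") (auto simp: n_def)
          then show ?thesis using i \<open>m \<le> i\<close> by simp
        qed simp
        then show "chain_sum v x - (if m < n then chain_sum v (xs ! m) else 0) \<le> v $ x"
          using chain_sum_nonneg[of v "xs ! m"] by auto
      qed
      finally show ?thesis by simp
    qed
  qed
  moreover have "(\<Sum>k\<le>n. (a k - a (Suc k)) *\<^sub>R p k) \<in> convex hull simplex_vertices xs"
  proof (rule convex_sum)
    show "(\<Sum>k\<le>n. a k - a (Suc k)) = 1" unfolding sum_telescope by (simp add: a_def)
    show "p k \<in> convex hull simplex_vertices xs" if "k \<in> {..n}" for k
      using that by (intro hull_inc) (auto simp: p_def n_def simplex_vertices_def)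
  qed (use decr in auto)
  ultimately show ?thesis using that xs(1) by simp
qed

section \<open>The triangulation\<close>

lemma rho_eq_sum_axis: "rho F = (\<Sum>x\<in>min_elems F. axis x 1)"
  by (simp add: vec_eq_iff axis_def sum.delta' of_bool_def)

lemma finite_simplex_vertices: "finite (simplex_vertices xs)"
  by (simp add: simplex_vertices_def)

lemma zero_in_simplex_vertices: "0 \<in> simplex_vertices xs"
  unfolding simplex_vertices_def
  by (rule image_eqI[of _ _ 0]) (auto simp: vec_eq_iff min_elems_def)

text \<open>A triangular system: \<open>xs ! j\<close> is minimal in the prefix that it ends, and
  the other minimal elements of this prefix are listed earlier, so induction applies.\<close>

lemma axis_in_int_combinations:
  assumes xs: "linear_extension xs" and "j < length xs"
  shows "axis (xs ! j) 1 \<in> int_combinations (simplex_vertices xs)"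
  using assms(2)
proof (induction j rule: less_induct)
  case (less j)
  let ?F = "set (take (Suc j) xs)"
  obtain m where "j < m" "m \<le> length xs"
      "\<forall>k\<le>length xs. xs ! j \<in> min_elems (set (take k xs)) \<longleftrightarrow> j < k \<and> k \<le> m"
    by (rule min_elems_take_interval[OF xs less.prems]) blast
  then have j: "xs ! j \<in> min_elems ?F" using less.prems by auto
  have "rho ?F \<in> simplex_vertices xs" using less.prems by (auto simp: simplex_vertices_def)
  then have "rho ?F \<in> int_combinations (simplex_vertices xs)"
    by (intro int_combinations_base finite_simplex_vertices)
  moreover have "axis y 1 \<in> int_combinations (simplex_vertices xs)"
    if y: "y \<in> min_elems ?F - {xs ! j}" for y
  proof -
    have "y \<in> ?F" using y by (simp add: min_elems_def)
    then obtain i where i: "i < length xs" "i < Suc j" "y = xs ! i"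
      unfolding in_set_take_conv_nth by blast
    then have "i < j" using y by (cases "i = j") auto
    then show ?thesis using less.IH[of i] i by simp
  qed
  \<comment> \<open>The coefficient \<open>of_int 1\<close> brings the sum into the form of
    \<open>int_combinations_sum\<close>.\<close>
  then have "(\<Sum>y\<in>min_elems ?F - {xs ! j}. of_int 1 *\<^sub>R axis y (1::real))
      \<in> int_combinations (simplex_vertices xs)"
    by (rule int_combinations_sum)
  moreover have "rho ?F = axis (xs ! j) 1 + (\<Sum>y\<in>min_elems ?F - {xs ! j}. of_int 1 *\<^sub>R axis y 1)"
    unfolding rho_eq_sum_axis using j by (simp add: sum.remove)
  ultimately show ?case using int_combinations_diff by force
qed

lemma coord_space_expansion:
  assumes "v \<in> coord_space P"
  shows "v = (\<Sum>x\<in>P. v $ x *\<^sub>R axis x 1)"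
proof -
  have "v $ i = (\<Sum>x\<in>P. v $ x *\<^sub>R axis x 1) $ i" for i
  proof -
    have "(\<Sum>x\<in>P. v $ x *\<^sub>R axis x 1) $ i = (\<Sum>x\<in>P. if x = i then v $ x else 0)"
      unfolding sum_component by (intro sum.cong) (auto simp: axis_def)
    also have "\<dots> = v $ i" using assms by (simp add: coord_space_def)
    finally show ?thesis by (rule sym)
  qed
  then show ?thesis unfolding vec_eq_iff by blast
qed

lemma lattice_points_int_combinations:
  assumes xs: "linear_extension xs" and z: "z \<in> lattice_points (coord_space P)"
  shows "z \<in> int_combinations (simplex_vertices xs)"
proof -
  have "\<forall>x. \<exists>k :: int. z $ x = of_int k" using z by (auto simp: lattice_points_def elim: Ints_cases)
  then obtain k :: "'a \<Rightarrow> int" where k: "\<And>x. z $ x = of_int (k x)" by metis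
  have "axis x 1 \<in> int_combinations (simplex_vertices xs)" if "x \<in> P" for x
  proof -
    have "x \<in> set xs" using xs that by (simp add: linear_extension_def)
    then show ?thesis using axis_in_int_combinations[OF xs] by (auto simp: in_set_conv_nth)
  qed
  then have "(\<Sum>x\<in>P. of_int (k x) *\<^sub>R axis x 1) \<in> int_combinations (simplex_vertices xs)"
    by (rule int_combinations_sum)
  moreover have "z \<in> coord_space P" using z by (simp add: lattice_points_def)
  then have "z = (\<Sum>x\<in>P. of_int (k x) *\<^sub>R axis x 1)"
    unfolding k[symmetric] by (rule coord_space_expansion)
  ultimately show ?thesis by simp
qed

lemma card_simplex_vertices:
  assumes xs: "linear_extension xs"
  shows "card (simplex_vertices xs) = Suc (card P)"
proof -
  have dist: "distinct xs" and P: "set xs = P" using xs by (auto simp: linear_extension_def)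
  have "inj_on (\<lambda>k. rho (set (take k xs))) {..length xs}"
  proof (rule inj_onI)
    fix i j assume ij: "i \<in> {..length xs}" "j \<in> {..length xs}"
      "rho (set (take i xs)) = rho (set (take j xs))"
    then have "set (take i xs) = set (take j xs)"
      using rho_inj take_in_up_sets[OF xs] by (auto dest: inj_onD)
    then have "card (set (take i xs)) = card (set (take j xs))" by simp
    then show "i = j" using ij dist by (simp add: distinct_card)
  qed
  then show ?thesis
    unfolding simplex_vertices_def P[symmetric] using dist by (simp add: card_image distinct_card)
qed

text \<open>The nonzero vertices are \<open>card P\<close> many and span a space of at least that
  dimension, so they are linearly independent; the remaining vertex is the origin.\<close>

lemma simplex_vertices_independent:
  assumes xs: "linear_extension xs"
  shows "\<not> affine_dependent (simplex_vertices xs)"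
proof -
  let ?S = "simplex_vertices xs"
  have axis: "axis x 1 \<in> span (?S - {0})" if "x \<in> P" for x :: 'a
  proof -
    have "axis x 1 \<in> int_combinations ?S"
      using that by (intro lattice_points_int_combinations[OF xs])
        (auto simp: lattice_points_def coord_space_def axis_def)
    then show ?thesis
      unfolding int_combinations_def
      by (auto intro!: span_sum span_scale simp: span_delete_0 intro: span_base)
  qed
  have "independent (?S - {0})"
  proof (rule card_le_dim_spanning[of _ "coord_space P"])
    have "?S \<subseteq> chain_polytope P r"
      using simplex_vertices_subset[OF xs] by (auto simp: lattice_points_def)
    then show "?S - {0} \<subseteq> coord_space P" by (auto simp: chain_polytope_iff)
    show "coord_space P \<subseteq> span (?S - {0})"
    proof
      fix v assume "v \<in> coord_space P"
      then have "v = (\<Sum>x\<in>P. v $ x *\<^sub>R axis x 1)" by (rule coord_space_expansion)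
      also have "\<dots> \<in> span (?S - {0})" by (intro span_sum span_scale axis)
      finally show "v \<in> span (?S - {0})" .
    qed
    show "finite (?S - {0})" using finite_simplex_vertices by simp
    let ?A = "(\<lambda>x. axis x 1) ` P :: (real ^ 'a) set"
    have "card (?S - {0}) = card P"
      using card_simplex_vertices[OF xs] zero_in_simplex_vertices by simp
    also have "\<dots> = card ?A" by (intro card_image[symmetric] inj_onI) (simp add: axis_eq_axis)
    also have "\<dots> \<le> dim (coord_space P)"
    proof (rule independent_card_le_dim)
      show "?A \<subseteq> coord_space P" by (auto simp: coord_space_def axis_def)
      have "?A \<subseteq> Basis" by (auto simp: axis_in_Basis_iff)
      then show "independent ?A" by (rule independent_mono[OF independent_Basis])
    qed
    finally show "card (?S - {0}) \<le> dim (coord_space P)" .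
  qed
  then have "\<not> affine_dependent (insert 0 (?S - {0}))"
    using affine_dependent_imp_dependent2 by blast
  then show ?thesis using zero_in_simplex_vertices by (simp add: insert_absorb)
qed

lemma unimodular_simplex_hull:
  assumes xs: "linear_extension xs"
  shows "unimodular_simplex P (convex hull simplex_vertices xs)"
proof -
  let ?S = "simplex_vertices xs"
  note indep = simplex_vertices_independent[OF xs]
  have vert: "vertices (convex hull ?S) = ?S"
    unfolding vertices_def using extreme_point_of_convex_hull_affine_independent[OF indep] by simp
  have "?S \<subseteq> lattice_points (coord_space P)"
    using simplex_vertices_subset[OF xs] by (auto simp: lattice_points_def chain_polytope_iff)
  moreover have "w - v \<in> lattice_points (coord_space P)"
    if "v \<in> lattice_points (coord_space P)" "w \<in> lattice_points (coord_space P)" for v w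
    using that by (simp add: lattice_points_def coord_space_def)
  ultimately have "w - v \<in> lattice_points (coord_space P)" if "v \<in> ?S" "w \<in> ?S" for v w
    using that by blast
  then have "integer_basis ((\<lambda>w. w - v) ` (?S - {v})) (lattice_points (coord_space P))"
    if "v \<in> ?S" for v
    using that zero_in_simplex_vertices lattice_points_int_combinations[OF xs]
    by (intro integer_basis_edges[OF indep]) (auto simp: int_combinations_def)
  moreover have "int (card P) simplex (convex hull ?S)"
    using indep card_simplex_vertices[OF xs] by (intro simplex_convex_hull) simp
  ultimately show ?thesis unfolding unimodular_simplex_def vert by blast
qed

section \<open>The cells of the height function\<close>

text \<open>Supporting functionals make each full simplex a cell, and tilting gives its faces.
  Conversely, the barycentre of a nonempty cell lies in some simplex; as its weights are all
  nonzero, \<open>regular_cell_support\<close> puts the whole cell into that simplex.\<close>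

lemma regular_cell_height_iff:
  "regular_cell height (lattice_points (chain_polytope P r)) S \<longleftrightarrow>
    (\<exists>xs. linear_extension xs \<and> S \<subseteq> simplex_vertices xs)" (is "regular_cell _ ?V S \<longleftrightarrow> _")
proof -
  have fin: "finite ?V" unfolding lattice_points_eq by simp
  have full: "regular_cell height ?V (simplex_vertices xs)" if xs: "linear_extension xs" for xs
  proof -
    obtain c where "\<And>v. v \<in> ?V \<Longrightarrow> 0 \<le> inner c v + height v"
      "\<And>v. v \<in> ?V \<Longrightarrow> inner c v + height v = 0 \<longleftrightarrow> v \<in> simplex_vertices xs"
      using supporting_functional[OF xs] by metis
    then show ?thesis
      unfolding regular_cell_def using simplex_vertices_subset[OF xs]
      by (intro exI[of _ c] exI[of _ "1::real"] exI[of _ "0::real"]) auto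
  qed
  show ?thesis
  proof
    assume S: "regular_cell height ?V S"
    show "\<exists>xs. linear_extension xs \<and> S \<subseteq> simplex_vertices xs"
    proof (cases "S = {}")
      case True
      obtain xs where "linear_extension xs" using linear_extension_exists[of "\<lambda>_. 0"] by auto
      then show ?thesis using True by blast
    next
      case False
      have "S \<subseteq> ?V" using S by (auto simp: regular_cell_def)
      then have finS: "finite S" using fin finite_subset by blast
      define u where "u v = 1 / real (card S)" for v :: "real ^ 'a"
      have u: "sum u S = 1" "\<And>v. 0 \<le> u v" "\<And>v. u v \<noteq> 0"
        using False finS by (auto simp: u_def)
      have "S \<subseteq> chain_polytope P r" using \<open>S \<subseteq> ?V\<close> by (auto simp: lattice_points_def)
      then have "(\<Sum>v\<in>S. u v *\<^sub>R v) \<in> chain_polytope P r"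
        using u finS by (intro convex_sum convex_chain_polytope) auto
      then obtain xs where xs: "linear_extension xs"
          "(\<Sum>v\<in>S. u v *\<^sub>R v) \<in> convex hull simplex_vertices xs"
        by (rule chain_polytope_covered)
      then obtain w where w: "\<And>v. v \<in> simplex_vertices xs \<Longrightarrow> 0 \<le> w v"
          "sum w (simplex_vertices xs) = 1"
          "(\<Sum>v\<in>simplex_vertices xs. w v *\<^sub>R v) = (\<Sum>v\<in>S. u v *\<^sub>R v)"
        by (auto simp: convex_hull_finite[OF finite_simplex_vertices])
      have "v \<in> simplex_vertices xs" if "v \<in> S" for v
        using regular_cell_support[OF full[OF xs(1)] S fin w(1,2) u(2) u(1) w(3) that u(3)] .
      then show ?thesis using xs(1) by blast
    qed
  next
    assume "\<exists>xs. linear_extension xs \<and> S \<subseteq> simplex_vertices xs"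
    then obtain xs where "linear_extension xs" "S \<subseteq> simplex_vertices xs" by blast
    then show "regular_cell height ?V S"
      using regular_cell_subset[OF full fin simplex_vertices_independent] by blast
  qed
qed

section \<open>Flagness\<close>

text \<open>The number of members of \<open>\<F>\<close> that contain an element is monotone, and
  listing by it makes every member a prefix.\<close>

lemma nested_up_sets_in_simplex:
  assumes up: "\<F> \<subseteq> up_sets" and nested: "\<And>F G. F \<in> \<F> \<Longrightarrow> G \<in> \<F> \<Longrightarrow> F \<subseteq> G \<or> G \<subseteq> F"
  obtains xs where "linear_extension xs" "rho ` \<F> \<subseteq> simplex_vertices xs"
proof -
  define u where "u x = real (card {F \<in> \<F>. x \<in> F})" for x
  have "u x \<le> u y" if "x \<in> P" "y \<in> P" "(x, y) \<in> r" for x y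
  proof -
    have "{F \<in> \<F>. x \<in> F} \<subseteq> {F \<in> \<F>. y \<in> F}" using up that unfolding up_sets_def by blast
    then show ?thesis unfolding u_def by (simp add: card_mono)
  qed
  then obtain xs where xs: "linear_extension xs" "sorted_wrt (\<lambda>x y. u y \<le> u x) xs"
    using linear_extension_exists by blast
  have "rho F \<in> simplex_vertices xs" if F: "F \<in> \<F>" for F
  proof -
    have "F \<subseteq> set xs" using F up xs(1) by (auto simp: up_sets_def linear_extension_def)
    moreover have "xs ! i \<in> F" if ij: "i < j" "j < length xs" "xs ! j \<in> F" for i j
    proof (rule ccontr)
      assume i: "xs ! i \<notin> F"
      \<comment> \<open>A member containing \<open>xs ! i\<close> is not inside \<open>F\<close>, so
        it contains \<open>F\<close> and thereby \<open>xs ! j\<close>; \<open>F\<close> itself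
        makes the inclusion strict.\<close>
      have "{G \<in> \<F>. xs ! i \<in> G} \<subset> {G \<in> \<F>. xs ! j \<in> G}"
        using nested[OF F] ij(3) i F by blast
      then have "u (xs ! i) < u (xs ! j)" unfolding u_def by (simp add: psubset_card_mono)
      then show False using sorted_wrt_nth_less[OF xs(2) ij(1,2)] by simp
    qed
    ultimately obtain k where "k \<le> length xs" "F = set (take k xs)"
      by (rule initial_segment_eq_take) blast
    then show ?thesis by (auto simp: simplex_vertices_def)
  qed
  then show ?thesis using that xs(1) by blast
qed


text \<open>Nested families are faces, so a non-face contains the vectors of two incomparable
  up-sets. Prefixes of one list are nested, so this pair is already a non-face, and by minimality it
  is everything.\<close>

lemma flag_complex_subsets_of_simplices:
  "flag_complex {S. \<exists>xs. linear_extension xs \<and> S \<subseteq> simplex_vertices xs}" (is "flag_complex ?K")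
  unfolding flag_complex_def
proof (intro allI impI, elim conjE)
  fix W assume W: "W \<subseteq> \<Union>?K" "W \<notin> ?K" "\<forall>W'. W' \<subset> W \<longrightarrow> W' \<in> ?K"
  have "\<Union>?K \<subseteq> rho ` up_sets"
    using simplex_vertices_subset unfolding lattice_points_eq by blast
  then have "W \<subseteq> rho ` up_sets" using W(1) by blast
  then have image: "W = rho ` {F \<in> up_sets. rho F \<in> W}" by blast
  obtain F G where FG: "F \<in> up_sets" "G \<in> up_sets" "rho F \<in> W" "rho G \<in> W"
      "\<not> F \<subseteq> G" "\<not> G \<subseteq> F"
  proof (rule ccontr)
    assume "\<not> thesis"
    with that have nested: "F \<subseteq> G \<or> G \<subseteq> F"
      if "F \<in> {F \<in> up_sets. rho F \<in> W}" "G \<in> {F \<in> up_sets. rho F \<in> W}" for F G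
      using that by blast
    have "{F \<in> up_sets. rho F \<in> W} \<subseteq> up_sets" by blast
    from nested_up_sets_in_simplex[OF this nested] obtain xs where
      "linear_extension xs" "rho ` {F \<in> up_sets. rho F \<in> W} \<subseteq> simplex_vertices xs" by blast
    then have "W \<in> ?K" using image by auto
    then show False using W(2) by blast
  qed
  have pair: "{rho F, rho G} \<notin> ?K"
  proof
    assume "{rho F, rho G} \<in> ?K"
    then obtain xs i j where xs: "linear_extension xs"
        "rho F = rho (set (take i xs))" "rho G = rho (set (take j xs))"
      by (auto simp: simplex_vertices_def)
    then have "F = set (take i xs)" "G = set (take j xs)"
      using FG(1,2) take_in_up_sets rho_inj by (auto dest: inj_onD)
    then show False
      using FG(5,6) set_take_subset_set_take[of i j xs] set_take_subset_set_take[of j i xs]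
      by (cases "i \<le> j") auto
  qed
  have "\<not> {rho F, rho G} \<subset> W"
  proof
    assume "{rho F, rho G} \<subset> W"
    then have "{rho F, rho G} \<in> ?K" by (rule W(3)[rule_format])
    with pair show False by (rule notE)
  qed
  then have "W = {rho F, rho G}" using FG(3,4) by auto
  moreover have "rho F \<noteq> rho G" using FG rho_inj by (auto dest: inj_onD)
  ultimately show "card W = 2" by simp
qed

section \<open>Assembly of the triangulation\<close>

text \<open>\<open>K\<close> has two descriptions: as subsets of simplices its members are affinely
  independent and closed under subsets; as cells they meet properly and are regular.\<close>

lemma triangulation_exists:
  "\<exists>T. lattice_triangulation (chain_polytope P r) T \<and>
     regular_triangulation (chain_polytope P r) T \<and>
     unimodular_triangulation P T \<and> flag_complex (underlying_complex T)"
proof -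
  let ?V = "lattice_points (chain_polytope P r)"
  define K where "K = {S. \<exists>xs. linear_extension xs \<and> S \<subseteq> simplex_vertices xs}"
  define T where "T = (hull) convex ` K"
  have finV: "finite ?V" unfolding lattice_points_eq by simp
  have K_cell: "K = {S. regular_cell height ?V S}" unfolding K_def regular_cell_height_iff ..
  have sub: "S \<subseteq> ?V" if "S \<in> K" for S
    using that unfolding K_cell regular_cell_def by blast
  have indep: "\<not> affine_dependent S" if "S \<in> K" for S
    using that simplex_vertices_independent affine_independent_subset unfolding K_def by blast
  have vert: "vertices (convex hull S) = S" if "S \<in> K" for S
    unfolding vertices_def
    using extreme_point_of_convex_hull_affine_independent[OF indep[OF that]] by simp
  have down: "S' \<in> K" if "S \<in> K" "S' \<subseteq> S" for S S'
    using that unfolding K_def by blast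
  have "simplicial_complex T"
    unfolding simplicial_complex_def
  proof (intro conjI ballI allI impI)
    have "K \<subseteq> Pow ?V" using sub by blast
    then show "finite T" unfolding T_def using finV finite_subset by blast
  next
    fix X assume "X \<in> T"
    then obtain S where S: "S \<in> K" "X = convex hull S" unfolding T_def by blast
    \<comment> \<open>The dimension is an integer, equal to -1 for the empty member.\<close>
    then show "\<exists>n. n simplex X"
      using indep by (intro exI[of _ "int (card S) - 1"]) (simp add: simplex_convex_hull)
  next
    fix F X assume "X \<in> T \<and> F face_of X"
    then obtain S where S: "S \<in> K" "F face_of convex hull S" unfolding T_def by blast
    have "compact S" using sub[OF S(1)] finV by (intro finite_imp_compact) (rule finite_subset)
    then obtain S' where "S' \<subseteq> S" "F = convex hull S'"
      using face_of_convex_hull_subset[OF _ S(2)] by blast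
    then show "F \<in> T" unfolding T_def using down[OF S(1)] by blast
  next
    fix X Y assume "X \<in> T \<and> Y \<in> T"
    then obtain S S' where S: "S \<in> K" "S' \<in> K" "X = convex hull S" "Y = convex hull S'"
      unfolding T_def by blast
    then have "X \<inter> Y = convex hull (S \<inter> S')"
      unfolding K_cell using regular_cell_Int[OF _ _ finV] by blast
    then show "X \<inter> Y face_of X"
      unfolding S(3) by (simp add: face_of_convex_hull_affine_independent[OF indep[OF S(1)]]) blast
  qed
  moreover have "\<Union>T = chain_polytope P r"
  proof (intro equalityI subsetI)
    fix v assume "v \<in> \<Union>T"
    then obtain S where S: "S \<in> K" "v \<in> convex hull S" unfolding T_def by blast
    have "convex hull S \<subseteq> chain_polytope P r"
      using sub[OF S(1)] by (intro hull_minimal convex_chain_polytope) (auto simp: lattice_points_def)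
    then show "v \<in> chain_polytope P r" using S(2) by blast
  next
    fix v assume "v \<in> chain_polytope P r"
    then obtain xs where "linear_extension xs" "v \<in> convex hull simplex_vertices xs"
      by (rule chain_polytope_covered)
    then show "v \<in> \<Union>T" unfolding T_def K_def by blast
  qed
  moreover have "\<forall>X\<in>T. vertices X \<subseteq> ?V" unfolding T_def using vert sub by auto
  ultimately have "lattice_triangulation (chain_polytope P r) T"
    unfolding lattice_triangulation_def by blast
  moreover have "regular_triangulation (chain_polytope P r) T"
    unfolding regular_triangulation_def lower_faces_convex_hull[OF finV] T_def K_cell by blast
  moreover have "unimodular_triangulation P T"
    unfolding unimodular_triangulation_def
  proof (intro ballI impI)
    fix X assume X: "X \<in> T" "\<forall>X'\<in>T. X \<subseteq> X' \<longrightarrow> X' = X"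
    then obtain S xs where S: "X = convex hull S" "linear_extension xs" "S \<subseteq> simplex_vertices xs"
      unfolding T_def K_def by blast
    \<comment> \<open>A maximal member lies in a full simplex, which is itself a member, and hence
      equals it.\<close>
    have "convex hull simplex_vertices xs \<in> T" unfolding T_def K_def using S(2) by blast
    then have "X = convex hull simplex_vertices xs" using X(2) S hull_mono by metis
    then show "unimodular_simplex P X" using unimodular_simplex_hull[OF S(2)] by simp
  qed
  moreover have "underlying_complex T = K"
    unfolding underlying_complex_def T_def image_image using vert by simp
  then have "flag_complex (underlying_complex T)"
    using flag_complex_subsets_of_simplices by (simp add: K_def)
  ultimately show ?thesis by blast
qed

end

theorem corollary3p1:
  fixes P :: "'a::finite set" and r :: "'a rel"
  assumes "partial_order_on P r"
  shows "\<exists>T. lattice_triangulation (chain_polytope P r) T \<and>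
             regular_triangulation (chain_polytope P r) T \<and>
             unimodular_triangulation P T \<and>
             flag_complex (underlying_complex T)"
proof -
  interpret finite_poset P r by unfold_locales (rule assms)
  show ?thesis by (rule triangulation_exists)
qed

end
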